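(* For every $0<s\leq 1$ there exists a sequence of discrete probability measures $\nu_k=\sum_{j}p_{j,k}\,\delta_{x_{j,k}}$, $k=1,2,\dots$ (each a finite sum, with positive weights $p_{j,k}$ and, for each $k$, distinct points $x_{j,k}\in\mathbb{R}$), such that the weak limit $$\mu:=\lim_{k\to\infty}\nu_1*\nu_2*\cdots*\nu_k$$ exists and is a probability measure on $[0,1]$ with $\dim_{\mathcal H}(\operatorname{supp}\mu)=s$, such that for every $\epsilon>0$ there is $C_\epsilon$ with $|\widehat{\mu}(\xi)|\leq C_\epsilon|\xi|^{-s/2+\epsilon}$ for all $|\xi|\geq 1$, while $$\lim_{k\to\infty}\frac{\max_{j_1,\dots,j_k}p_{j_1,1}\cdots p_{j_k,k}}{\min_{j_1,\dots,j_k}p_{j_1,1}\cdots p_{j_k,k}}=\infty.$$ Moreover, $\mu$ is almost Ahlfors–David regular: for every $\epsilon>0$ there are constants $c_\epsilon,C_\epsilon>0$ such that $$c_\epsilon r^{s+\epsilon}\leq\mu(B(x,r))\leq C_\epsilon r^{s-\epsilon}\quad\text{for all }x\in\operatorname{supp}\mu,\ 0<r\leq 1.$$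
   Context: $\widehat{\mu}(\xi)=\int e^{-2\pi i x\xi}\,d\mu(x)$; $\delta_x$ is the Dirac mass at $x$; $\dim_{\mathcal H}$ is Hausdorff dimension; $B(x,r)$ is the interval of radius $r$ centered at $x$. *)

theory Defs
  imports "HOL-Probability.Probability"
begin

definition discrete_measure :: "nat \<Rightarrow> (nat \<Rightarrow> real) \<Rightarrow> (nat \<Rightarrow> real) \<Rightarrow> real measure" where
  "discrete_measure n p x =
     measure_of UNIV (sets borel)
       (\<lambda>A. \<Sum>j<n. ennreal (p j) * emeasure (return borel (x j)) A)"

lemma sets_discrete_measure [simp]: "sets (discrete_measure n p x) = sets borel"
  unfolding discrete_measure_def
  by (metis sets.sigma_sets_eq sets_measure_of space_borel subset_UNIV Pow_UNIV)

text \<open>The set function in the definition is countably additive, so \<open>measure_of\<close>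
  does not fall back to the zero measure.\<close>

lemma emeasure_discrete_measure:
  assumes "A \<in> sets borel"
  shows "emeasure (discrete_measure n p x) A
           = (\<Sum>j<n. ennreal (p j) * emeasure (return borel (x j)) A)"
proof (rule emeasure_measure_of[OF discrete_measure_def])
  show "countably_additive (sets (discrete_measure n p x))
          (\<lambda>A. \<Sum>j<n. ennreal (p j) * emeasure (return borel (x j)) A)"
  proof (rule countably_additiveI)
    fix F :: "nat \<Rightarrow> real set"
    assume F: "range F \<subseteq> sets (discrete_measure n p x)" "disjoint_family F"
    have "(\<Sum>i. \<Sum>j<n. ennreal (p j) * emeasure (return borel (x j)) (F i))
        = (\<Sum>j<n. \<Sum>i. ennreal (p j) * emeasure (return borel (x j)) (F i))"
      by (rule suminf_sum) simp
    also have "\<dots> = (\<Sum>j<n. ennreal (p j) * emeasure (return borel (x j)) (\<Union>i. F i))"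
      using F by (intro sum.cong) (auto simp: suminf_emeasure simp del: emeasure_return)
    finally show "(\<Sum>i. \<Sum>j<n. ennreal (p j) * emeasure (return borel (x j)) (F i))
        = (\<Sum>j<n. ennreal (p j) * emeasure (return borel (x j)) (\<Union>i. F i))" .
  qed
qed (use assms in \<open>auto simp: positive_def\<close>)

text \<open>\<open>conv_upto \<nu> k\<close> is \<open>\<nu> 1 * \<dots> * \<nu> k\<close>; the entry \<open>\<nu> 0\<close> is never used, and the
  empty convolution is the unit mass at 0.\<close>

primrec conv_upto :: "(nat \<Rightarrow> real measure) \<Rightarrow> nat \<Rightarrow> real measure" where
  "conv_upto \<nu> 0 = return borel 0"
| "conv_upto \<nu> (Suc k) = convolution (conv_upto \<nu> k) (\<nu> (Suc k))"

definition measure_supp :: "'a::topological_space measure \<Rightarrow> 'a set" where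
  "measure_supp M = {x. \<forall>U. open U \<and> x \<in> U \<longrightarrow> 0 < emeasure M U}"

text \<open>The library's \<open>char\<close> uses the kernel \<open>exp(i t x)\<close>; this is the \<open>exp(-2\<pi>i x \<xi>)\<close>
  normalisation.\<close>

definition fourier_measure :: "real measure \<Rightarrow> real \<Rightarrow> complex" where
  "fourier_measure M \<xi> = (CLINT x|M. exp (- 2 * of_real pi * \<i> * of_real x * of_real \<xi>))"

text \<open>\<open>diam(U)\<^sup>t\<close> with the usual conventions \<open>0\<^sup>0 = 1\<close> for nonempty \<open>U\<close> and value 0 for the
  empty set (whereas \<open>0 powr 0 = 0\<close>).\<close>

definition diam_power :: "real \<Rightarrow> 'a::metric_space set \<Rightarrow> ennreal" where
  "diam_power t U =
     (if U = {} then 0 else if t = 0 then 1 else ennreal (diameter U powr t))"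

text \<open>Boundedness is required explicitly because \<open>diameter\<close> is meaningless on unbounded sets.\<close>

definition hausdorff_premeasure :: "real \<Rightarrow> real \<Rightarrow> 'a::metric_space set \<Rightarrow> ennreal" where
  "hausdorff_premeasure t \<delta> E =
     (INF U \<in> {U :: nat \<Rightarrow> 'a set. E \<subseteq> (\<Union>i. U i) \<and> (\<forall>i. bounded (U i) \<and> diameter (U i) \<le> \<delta>)}.
        \<Sum>i. diam_power t (U i))"

definition hausdorff_measure :: "real \<Rightarrow> 'a::metric_space set \<Rightarrow> ennreal" where
  "hausdorff_measure t E = (SUP \<delta> \<in> {0<..}. hausdorff_premeasure t \<delta> E)"

definition hausdorff_dim :: "'a::metric_space set \<Rightarrow> ennreal" where
  "hausdorff_dim E = Inf {ennreal t | t. 0 \<le> t \<and> hausdorff_measure t E = 0}"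

end

theory Submission
  imports Defs "HOL-Real_Asymp.Real_Asymp"
begin

text \<open>Stage \<open>k\<close> has \<open>N = 2 ^ k\<close> atoms, one in each slot of a regular subdivision of a cell of the
  previous stage, moved inside its slot by a random amount. Conditions at different stages do not
  interact: by Hoeffding's inequality and a union bound over a fine grid of frequencies the jitter of
  stage \<open>k\<close> can be fixed such that its Fourier transform is at most a polynomial in \<open>k\<close> times
  \<open>N powr (- 1 / 2)\<close>, from the frequency scale of the stage up to frequencies beyond
  any fixed power of \<open>N\<close>. At a given frequency all but a negligible part of the
  relevant factors is therefore of square-root size, and their product is \<open>|\<xi>| powr (- s / 2)\<close> up to
  losses of the form \<open>2 powr o(k\<^sup>2)\<close>, while \<open>|\<xi>|\<close> is \<open>2 powr\<close> (a quadratic in \<open>k\<close>). For the same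
  reason one may give one atom of each stage twice the weight of the others: the ratio of the weights
  of words becomes \<open>2 ^ k\<close>, which changes neither the dimension nor the regularity exponents.\<close>

text \<open>The number of atoms grows because every stage loses a factor in the estimates: for
  bounded \<open>N\<close> a constant loss per stage would multiply up to a fixed power of the
  frequency, whereas a polynomial in \<open>k\<close> is small against \<open>2 ^ k\<close>. Two
  limits restrict the frequencies at which a stage is controlled. Below the inverse range of the
  jitter its mean does not oscillate, which costs a bounded number of the finest relevant stages.
  Above, the union bound covers only a bounded window, which costs the coarsest ones. Ending the
  window of stage \<open>k\<close> at the inverse cell length of generation \<open>k\<^sup>2\<close>
  balances the demands: the logarithm of the number of grid points is of order \<open>k ^ 4\<close>,
  so a Hoeffding threshold of order \<open>k\<^sup>2\<close> suffices, and the stages outside their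
  windows are few. The limit measure is the law of a series of independent digits. Masses of
  cylinders are then products of weights, and the partial convolutions converge because the series
  does. A characteristic function has modulus at most 1, so uncontrolled stages can be given
  up.\<close>

section \<open>Discrete measures and independent coordinates\<close>

lemma discrete_measure_eq_distr:
  assumes "\<And>j. j < n \<Longrightarrow> 0 \<le> p j"
  shows "discrete_measure n p x = distr (point_measure {..<n} (\<lambda>j. ennreal (p j))) borel x"
proof (rule measure_eqI)
  fix A assume "A \<in> sets (discrete_measure n p x)"
  then have A: "A \<in> sets borel" by simp
  have "emeasure (distr (point_measure {..<n} (\<lambda>j. ennreal (p j))) borel x) A
      = emeasure (point_measure {..<n} (\<lambda>j. ennreal (p j))) (x -` A \<inter> {..<n})"
    using A by (subst emeasure_distr) (auto simp: space_point_measure)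
  also have "\<dots> = (\<Sum>j\<in>x -` A \<inter> {..<n}. ennreal (p j))"
    by (rule emeasure_point_measure_finite) auto
  also have "\<dots> = (\<Sum>j<n. ennreal (p j) * emeasure (return borel (x j)) A)"
    using A by (intro sum.mono_neutral_cong_left) (auto simp: indicator_def)
  finally show "emeasure (discrete_measure n p x) A
      = emeasure (distr (point_measure {..<n} (\<lambda>j. ennreal (p j))) borel x) A"
    using A by (simp add: emeasure_discrete_measure)
qed simp

lemma prob_space_discrete_measure:
  assumes "\<And>j. j < n \<Longrightarrow> 0 \<le> p j" "(\<Sum>j<n. p j) = 1"
  shows "prob_space (discrete_measure n p x)"
proof
  have "space (discrete_measure n p x) = UNIV"
    using sets_eq_imp_space_eq[OF sets_discrete_measure] by simp
  then show "emeasure (discrete_measure n p x) (space (discrete_measure n p x)) = 1"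
    using sum_ennreal[of "{..<n}" p] assms by (subst emeasure_discrete_measure) auto
qed

lemma AE_discrete_measure:
  assumes "\<And>j. j < n \<Longrightarrow> 0 \<le> p j"
  shows "AE y in discrete_measure n p x. y \<in> x ` {..<n}"
  by (subst discrete_measure_eq_distr[OF assms], assumption)
    (subst AE_distr_iff, auto simp: AE_point_measure intro!: borel_closed finite_imp_closed)

lemma measure_discrete_measure_singleton:
  assumes "\<And>j. j < n \<Longrightarrow> 0 \<le> p j" "inj_on x {..<n}" "j < n"
  shows "measure (discrete_measure n p x) {x j} = p j"
proof -
  have "emeasure (discrete_measure n p x) {x j}
      = (\<Sum>i<n. if i = j then ennreal (p i) else 0)"
    unfolding emeasure_discrete_measure[OF borel_singleton[OF sets.empty_sets]]
    using assms by (intro sum.cong) (auto simp: indicator_def inj_on_def)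
  also have "\<dots> = ennreal (p j)"
    using assms by simp
  finally show ?thesis
    using assms by (simp add: measure_def)
qed

lemma char_discrete_measure:
  assumes "\<And>j. j < n \<Longrightarrow> 0 \<le> p j"
  shows "char (discrete_measure n p x) t = (\<Sum>j<n. p j *\<^sub>R iexp (t * x j))"
  unfolding char_def
  by (subst discrete_measure_eq_distr[OF assms], assumption, subst integral_distr)
    (auto simp: assms intro!: lebesgue_integral_point_measure_finite simp del: of_real_mult)

lemma fourier_measure_eq_char: "fourier_measure M \<xi> = char M (- 2 * pi * \<xi>)"
  unfolding fourier_measure_def char_def
  by (rule Bochner_Integration.integral_cong) (auto simp: algebra_simps)

text \<open>The joint law of all coordinates is the product measure itself, hence the product of the
  marginals; subfamilies inherit independence. Serves both the digits of the Cantor measure and the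
  random jitter.\<close>

lemma indep_vars_PiM_coordinates:
  assumes "\<And>i. prob_space (N i)" "\<And>i. sets (N i) = sets borel" "J \<noteq> {}"
  shows "prob_space.indep_vars (PiM UNIV N) (\<lambda>_. borel) (\<lambda>i \<omega>. \<omega> i) J"
proof -
  interpret product_prob_space N UNIV
    using assms by (intro product_prob_spaceI)
  have [measurable]: "(\<lambda>\<omega>. \<omega> i) \<in> borel_measurable (PiM UNIV N)" for i
    using measurable_component_singleton[of i UNIV N] assms(2)[of i]
    by (simp cong: measurable_cong_sets)
  have d: "distr (PiM UNIV N) borel (\<lambda>\<omega>. \<omega> i) = N i" for i
    using PiM_component[of i] assms(2)[of i] by (simp cong: distr_cong)
  have "indep_vars (\<lambda>_. borel) (\<lambda>i \<omega>. \<omega> i) UNIV"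
  proof (subst indep_vars_iff_distr_eq_PiM')
    have "distr (PiM UNIV N) (PiM UNIV (\<lambda>_. borel)) (\<lambda>\<omega>. \<omega>) = distr (PiM UNIV N) (PiM UNIV N) (\<lambda>\<omega>. \<omega>)"
      by (intro distr_cong sets_PiM_cong) (auto simp: assms)
    then show "distr (PiM UNIV N) (PiM UNIV (\<lambda>_. borel)) (\<lambda>x. \<lambda>i\<in>UNIV. x i)
        = PiM UNIV (\<lambda>i. distr (PiM UNIV N) borel (\<lambda>x. x i))"
      by (simp add: d distr_id2 restrict_UNIV)
  qed auto
  then show ?thesis
    by (rule indep_vars_subset) auto
qed

section \<open>Infinite convolutions with separated atoms\<close>

text \<open>A word of length \<open>k\<close> determines an interval of length \<open>L k\<close>. The constant 3 in the separation
  condition leaves gaps of length at least \<open>2 * L k\<close> between these intervals, so that a ball of radius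
  at most \<open>L k\<close> centred in one of them meets no other.\<close>

locale separated_convolution =
  fixes n :: "nat \<Rightarrow> nat" and p x :: "nat \<Rightarrow> nat \<Rightarrow> real" and L :: "nat \<Rightarrow> real"
  assumes p_pos: "j < n k \<Longrightarrow> 0 < p j k"
    and p_sum: "(\<Sum>j<n k. p j k) = 1"
    and L_pos: "0 < L k"
    and L_lim: "L \<longlonglongrightarrow> 0"
    and x_nonneg: "j < n k \<Longrightarrow> 0 \<le> x j k"
    and x_nested: "j < n k \<Longrightarrow> x j k + L (Suc k) \<le> L k"
    and x_separated: "i < n k \<Longrightarrow> j < n k \<Longrightarrow> i \<noteq> j \<Longrightarrow> 3 * L (Suc k) \<le> \<bar>x i k - x j k\<bar>"
begin

definition stage :: "nat \<Rightarrow> real measure" where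
  "stage k = discrete_measure (n k) (\<lambda>j. p j k) (\<lambda>j. x j k)"

text \<open>The infinite convolution as the law of a random series. The default value of
  \<open>suminf\<close> on divergent sequences is taken on a null set only, by
  \<open>AE_digits\<close> and \<open>digits_sums\<close>.\<close>

definition limit_measure :: "real measure" where
  "limit_measure = distr (PiM UNIV stage) borel (\<lambda>\<omega>. \<Sum>k. \<omega> k)"

definition left_end :: "(nat \<Rightarrow> nat) \<Rightarrow> nat \<Rightarrow> real" where
  "left_end J k = (\<Sum>i<k. x (J i) i)"

definition cylinder :: "(nat \<Rightarrow> nat) \<Rightarrow> nat \<Rightarrow> real set" where
  "cylinder J k = {left_end J k .. left_end J k + L k}"

text \<open>\<open>cylinder J k\<close> depends only on the first \<open>k\<close> digits; taking
  words in \<open>PiE\<close> makes each generation a finite union, hence closed.\<close>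

definition cantor_set :: "real set" where
  "cantor_set = (\<Inter>k. \<Union>J\<in>(\<Pi>\<^sub>E i\<in>{..<k}. {..<n i}). cylinder J k)"

lemma p_nonneg: "j < n k \<Longrightarrow> 0 \<le> p j k"
  using p_pos by (simp add: less_imp_le)

lemma x_inj: "inj_on (\<lambda>j. x j k) {..<n k}"
proof (rule inj_onI, rule ccontr)
  fix i j assume "i \<in> {..<n k}" "j \<in> {..<n k}" "x i k = x j k" "i \<noteq> j"
  then show False using x_separated[of i k j] L_pos[of "Suc k"] by simp
qed

lemma prob_space_stage: "prob_space (stage k)"
  unfolding stage_def by (rule prob_space_discrete_measure) (auto simp: p_nonneg p_sum)

lemma sets_stage [simp]: "sets (stage k) = sets borel"
  by (simp add: stage_def)

lemma real_distribution_stage: "real_distribution (stage k)"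
  using prob_space_stage sets_eq_imp_space_eq[OF sets_stage]
  by (simp add: real_distribution_def real_distribution_axioms_def)

lemma char_stage: "char (stage k) t = (\<Sum>j<n k. p j k *\<^sub>R iexp (t * x j k))"
  unfolding stage_def by (rule char_discrete_measure) (simp add: p_nonneg)

sublocale seq: product_prob_space stage UNIV
  using prob_space_stage by (rule product_prob_spaceI)

lemma measurable_coordinate [measurable]: "(\<lambda>\<omega>. \<omega> i) \<in> borel_measurable (PiM UNIV stage)"
  using measurable_component_singleton[of i UNIV stage] by (simp cong: measurable_cong_sets)

lemma distr_coordinate: "distr (PiM UNIV stage) borel (\<lambda>\<omega>. \<omega> i) = stage i"
  using seq.PiM_component[of i] by (simp cong: distr_cong)

lemma real_distribution_limit_measure: "real_distribution limit_measure"
  unfolding limit_measure_def by (intro seq.real_distribution_distr) measurable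

lemma L_antimono: "j < n k \<Longrightarrow> L (Suc k) \<le> L k"
  using x_nonneg[of j k] x_nested[of j k] by linarith

lemma n_pos: "0 < n k"
  using p_sum[of k] by (cases "n k") auto

lemma decseq_L: "decseq L"
  using L_antimono n_pos by (intro decseq_SucI) blast

section \<open>Separation of cylinders and convergence of digit series\<close>

text \<open>Words that differ only in the last digit are apart by \<open>x_separated\<close>. If
  they differ earlier, the last digits bring them closer by at most \<open>L k - L (Suc k)\<close>,
  and the remaining \<open>2 * L k + L (Suc k)\<close> is at least
  \<open>3 * L (Suc k)\<close>.\<close>

lemma left_end_separated:
  assumes "\<And>i. i < k \<Longrightarrow> I i < n i" "\<And>i. i < k \<Longrightarrow> J i < n i" "i < k" "I i \<noteq> J i"
  shows "3 * L k \<le> \<bar>left_end I k - left_end J k\<bar>"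
  using assms
proof (induction k arbitrary: i)
  case (Suc k)
  have *: "left_end I (Suc k) - left_end J (Suc k)
      = (left_end I k - left_end J k) + (x (I k) k - x (J k) k)"
    by (simp add: left_end_def)
  have k: "I k < n k" "J k < n k" using Suc.prems by auto
  show ?case
  proof (cases "\<forall>i<k. I i = J i")
    case True
    then have "left_end I k = left_end J k" "I k \<noteq> J k"
      using Suc.prems(3,4) by (auto simp: left_end_def less_Suc_eq)
    then show ?thesis using * x_separated[OF k] by simp
  next
    case False
    then obtain i' where "i' < k" "I i' \<noteq> J i'" by blast
    then have "3 * L k \<le> \<bar>left_end I k - left_end J k\<bar>"
      using Suc.IH[of i'] Suc.prems(1,2) by simp
    moreover have "\<bar>x (I k) k - x (J k) k\<bar> \<le> L k - L (Suc k)"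
      using x_nonneg[OF k(1)] x_nonneg[OF k(2)] x_nested[OF k(1)] x_nested[OF k(2)] by linarith
    ultimately show ?thesis using * L_antimono[OF k(1)] by linarith
  qed
qed simp

lemma cylinder_disjoint:
  assumes "\<And>i. i < k \<Longrightarrow> I i < n i" "\<And>i. i < k \<Longrightarrow> J i < n i"
    and "a \<in> cylinder I k" "b \<in> cylinder J k" "\<bar>a - b\<bar> < 2 * L k" "i < k"
  shows "I i = J i"
proof (rule ccontr)
  assume "I i \<noteq> J i"
  from left_end_separated[OF assms(1,2,6) this] assms(3-5) show False
    by (auto simp: cylinder_def)
qed

text \<open>The term \<open>- L m\<close> makes the induction telescope: by \<open>x_nested\<close>
  the next digit uses up at most \<open>L m - L (Suc m)\<close>.\<close>

lemma left_end_le: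
  assumes "\<And>i. J i < n i" "k \<le> m"
  shows "left_end J k \<le> left_end J m" "left_end J m \<le> left_end J k + L k - L m"
proof -
  have "left_end J k \<le> left_end J m \<and> left_end J m \<le> left_end J k + L k - L m"
    using assms(2)
  proof (induction m rule: dec_induct)
    case (step m)
    then show ?case using x_nonneg[OF assms(1)[of m]] x_nested[OF assms(1)[of m]]
      by (auto simp: left_end_def)
  qed simp
  then show "left_end J k \<le> left_end J m" "left_end J m \<le> left_end J k + L k - L m" by auto
qed

lemma digits_sums:
  assumes "\<And>i. J i < n i"
  shows "left_end J \<longlonglongrightarrow> (\<Sum>k. x (J k) k)" and "(\<Sum>k. x (J k) k) \<in> cylinder J k"
proof -
  have "summable (\<lambda>k. x (J k) k)"
  proof (rule summableI_nonneg_bounded[where x = "L 0"])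
    show "(\<Sum>i<m. x (J i) i) \<le> L 0" for m
      using left_end_le(2)[OF assms, of 0 m] L_pos[of m] by (simp add: left_end_def)
  qed (simp add: x_nonneg assms)
  then show lim: "left_end J \<longlonglongrightarrow> (\<Sum>k. x (J k) k)"
    unfolding left_end_def by (rule summable_LIMSEQ)
  have "left_end J k \<le> left_end J m \<and> left_end J m \<le> left_end J k + L k" if "k \<le> m" for m
    using left_end_le[OF assms that] L_pos[of m] by simp
  then show "(\<Sum>k. x (J k) k) \<in> cylinder J k"
    unfolding cylinder_def atLeastAtMost_iff
    using LIMSEQ_le_const[OF lim] LIMSEQ_le_const2[OF lim] by blast
qed

lemma AE_digits:
  "AE \<omega> in PiM UNIV stage. \<exists>J. (\<forall>k. J k < n k) \<and> (\<forall>k. \<omega> k = x (J k) k)"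
proof -
  have "AE \<omega> in PiM UNIV stage. \<omega> k \<in> (\<lambda>j. x j k) ` {..<n k}" for k
  proof (rule seq.AE_component)
    show "AE y in stage k. y \<in> (\<lambda>j. x j k) ` {..<n k}"
      unfolding stage_def by (rule AE_discrete_measure) (simp add: p_nonneg)
  qed simp
  then have "AE \<omega> in PiM UNIV stage. \<forall>k. \<omega> k \<in> (\<lambda>j. x j k) ` {..<n k}"
    by (simp add: AE_all_countable)
  then show ?thesis
  proof eventually_elim
    case (elim \<omega>)
    then have "\<forall>k. \<exists>j. j < n k \<and> \<omega> k = x j k" by auto
    from choice[OF this] show ?case by auto
  qed
qed

section \<open>Masses of cylinders and balls, support\<close>

text \<open>Every digit series lies in the cylinders of its own word, and cylinders of one
  generation are disjoint. So, almost surely, the series falls into \<open>cylinder J k\<close>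
  exactly if its first \<open>k\<close> digits are those of \<open>J\<close>, and this event has
  product probability.\<close>

lemma measure_cylinder:
  assumes J: "\<And>i. i < k \<Longrightarrow> J i < n i"
  shows "measure limit_measure (cylinder J k) = (\<Prod>i<k. p (J i) i)"
proof -
  have "measure limit_measure (cylinder J k)
      = measure (PiM UNIV stage) {\<omega> \<in> space (PiM UNIV stage). (\<Sum>k. \<omega> k) \<in> cylinder J k}"
    unfolding limit_measure_def
    by (subst measure_distr) (auto simp: cylinder_def vimage_def intro!: arg_cong[where f = "measure _"])
  also have "\<dots> = measure (PiM UNIV stage)
      (prod_emb UNIV stage {..<k} (\<Pi>\<^sub>E i\<in>{..<k}. {x (J i) i}))"
  proof (rule measure_eq_AE)
    show "AE \<omega> in PiM UNIV stage.
        (\<omega> \<in> {\<omega> \<in> space (PiM UNIV stage). (\<Sum>k. \<omega> k) \<in> cylinder J k})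
      = (\<omega> \<in> prod_emb UNIV stage {..<k} (\<Pi>\<^sub>E i\<in>{..<k}. {x (J i) i}))"
      using AE_digits AE_space
    proof eventually_elim
      case (elim \<omega>)
      then obtain I where I: "\<And>i. I i < n i" "\<And>i. \<omega> i = x (I i) i" by auto
      have 1: "(\<Sum>k. \<omega> k) \<in> cylinder I k" using digits_sums(2)[OF I(1)] I(2) by simp
      have "((\<Sum>k. \<omega> k) \<in> cylinder J k) = (\<forall>i<k. x (I i) i = x (J i) i)"
      proof
        assume "(\<Sum>k. \<omega> k) \<in> cylinder J k"
        then show "\<forall>i<k. x (I i) i = x (J i) i"
          using cylinder_disjoint[OF I(1) J 1] L_pos[of k] by auto
      next
        assume "\<forall>i<k. x (I i) i = x (J i) i"
        then have "left_end I k = left_end J k" by (simp add: left_end_def)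
        with 1 show "(\<Sum>k. \<omega> k) \<in> cylinder J k" by (simp add: cylinder_def)
      qed
      also have "\<dots> = (\<omega> \<in> prod_emb UNIV stage {..<k} (\<Pi>\<^sub>E i\<in>{..<k}. {x (J i) i}))"
        using elim(2) I(2) by (auto simp: prod_emb_def space_PiM PiE_iff extensional_def)
      finally show ?case using elim(2) by simp
    qed
    show "{\<omega> \<in> space (PiM UNIV stage). (\<Sum>k. \<omega> k) \<in> cylinder J k} \<in> sets (PiM UNIV stage)"
      unfolding cylinder_def by measurable
    show "prod_emb UNIV stage {..<k} (\<Pi>\<^sub>E i\<in>{..<k}. {x (J i) i}) \<in> sets (PiM UNIV stage)"
      by (intro sets_PiM_I) auto
  qed
  also have "\<dots> = (\<Prod>i<k. measure (stage i) {x (J i) i})"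
    by (intro seq.measure_PiM_emb) auto
  also have "\<dots> = (\<Prod>i<k. p (J i) i)"
    unfolding stage_def using J measure_discrete_measure_singleton[OF p_nonneg x_inj]
    by (intro prod.cong) auto
  finally show ?thesis .
qed

lemma closed_cylinder_union: "closed (\<Union>J\<in>(\<Pi>\<^sub>E i\<in>{..<k}. {..<n i}). cylinder J k)"
  by (intro closed_UN finite_PiE) (auto simp: cylinder_def)

lemma cantor_set_borel [measurable]: "cantor_set \<in> sets borel"
  unfolding cantor_set_def using closed_cylinder_union by (intro sets.countable_INT) auto

lemma AE_cantor_set: "AE y in limit_measure. y \<in> cantor_set"
  unfolding limit_measure_def
proof (subst AE_distr_iff)
  show "AE \<omega> in PiM UNIV stage. (\<Sum>k. \<omega> k) \<in> cantor_set"
    using AE_digits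
  proof eventually_elim
    case (elim \<omega>)
    then obtain I where I: "\<And>i. I i < n i" "\<And>i. \<omega> i = x (I i) i" by auto
    have "(\<Sum>k. \<omega> k) \<in> cylinder (restrict I {..<k}) k" for k
      using digits_sums(2)[OF I(1), of k] I(2) by (simp add: cylinder_def left_end_def)
    moreover have "restrict I {..<k} \<in> (\<Pi>\<^sub>E i\<in>{..<k}. {..<n i})" for k
      using I(1) by auto
    ultimately show ?case unfolding cantor_set_def by blast
  qed
qed auto

lemma measure_cantor_set: "measure limit_measure cantor_set = 1"
proof -
  interpret lim: real_distribution limit_measure by (rule real_distribution_limit_measure)
  show ?thesis using AE_cantor_set by (subst lim.prob_eq_1) auto
qed

lemma measure_cantor_set_Int:
  assumes "A \<in> sets borel" shows "measure limit_measure (A \<inter> cantor_set) = measure limit_measure A"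
proof (rule measure_eq_AE)
  show "AE y in limit_measure. (y \<in> A \<inter> cantor_set) = (y \<in> A)"
    using AE_cantor_set by eventually_elim simp
qed (use assms in \<open>auto simp: limit_measure_def\<close>)

lemma mem_cantor_setE:
  assumes "y \<in> cantor_set"
  obtains J where "\<And>i. i < k \<Longrightarrow> J i < n i" "y \<in> cylinder J k"
proof -
  from assms obtain J where "J \<in> (\<Pi>\<^sub>E i\<in>{..<k}. {..<n i})" "y \<in> cylinder J k"
    unfolding cantor_set_def by blast
  then show ?thesis by (intro that[of J]) (auto simp: PiE_iff)
qed

text \<open>A ball of radius above \<open>L k\<close> contains the whole cylinder of generation
  \<open>k\<close> in which its centre lies. The bound \<open>c i\<close> depends on the stage
  alone, which makes the estimate uniform over words.\<close>

lemma measure_ball_ge: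
  assumes "y \<in> cantor_set" "L k < r" and p: "\<And>i j. j < n i \<Longrightarrow> c i \<le> p j i" "\<And>i. 0 \<le> c i"
  shows "(\<Prod>i<k. c i) \<le> measure limit_measure (ball y r)"
proof -
  interpret lim: real_distribution limit_measure by (rule real_distribution_limit_measure)
  obtain J where J: "\<And>i. i < k \<Longrightarrow> J i < n i" "y \<in> cylinder J k"
    using mem_cantor_setE[OF assms(1)] by blast
  have "(\<Prod>i<k. c i) \<le> (\<Prod>i<k. p (J i) i)" using J(1) p by (intro prod_mono) auto
  also have "\<dots> = measure limit_measure (cylinder J k)" using measure_cylinder[OF J(1)] by simp
  also have "\<dots> \<le> measure limit_measure (ball y r)"
    using J(2) assms(2) by (intro lim.finite_measure_mono) (auto simp: cylinder_def dist_real_def)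
  finally show ?thesis .
qed

lemma measure_ball_le:
  assumes "y \<in> cantor_set" "r \<le> L k" and p: "\<And>i j. j < n i \<Longrightarrow> p j i \<le> c i"
  shows "measure limit_measure (ball y r) \<le> (\<Prod>i<k. c i)"
proof -
  interpret lim: real_distribution limit_measure by (rule real_distribution_limit_measure)
  obtain J where J: "\<And>i. i < k \<Longrightarrow> J i < n i" "y \<in> cylinder J k"
    using mem_cantor_setE[OF assms(1)] by blast
  \<comment> \<open>The ball may stick out of the cylinder into the surrounding gaps; these carry no
    mass.\<close>
  have "measure limit_measure (ball y r) = measure limit_measure (ball y r \<inter> cantor_set)"
    by (rule measure_cantor_set_Int[symmetric]) simp
  also have "\<dots> \<le> measure limit_measure (cylinder J k)"
  proof (rule lim.finite_measure_mono)
    show "ball y r \<inter> cantor_set \<subseteq> cylinder J k"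
    proof
      fix z assume z: "z \<in> ball y r \<inter> cantor_set"
      then obtain I where I: "\<And>i. i < k \<Longrightarrow> I i < n i" "z \<in> cylinder I k"
        using mem_cantor_setE[of z k] by blast
      have "\<bar>z - y\<bar> < 2 * L k"
        using z assms(2) L_pos[of k] by (auto simp: dist_real_def)
      with cylinder_disjoint[OF I(1) J(1) I(2) J(2)] have "left_end I k = left_end J k"
        by (simp add: left_end_def)
      with I(2) show "z \<in> cylinder J k" by (simp add: cylinder_def)
    qed
  qed (simp add: cylinder_def)
  also have "\<dots> = (\<Prod>i<k. p (J i) i)" using measure_cylinder[OF J(1)] .
  also have "\<dots> \<le> (\<Prod>i<k. c i)" using J(1) p p_nonneg by (intro prod_mono) auto
  finally show ?thesis .
qed

text \<open>The complement of a finite generation is open and null, and each neighbourhood of a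
  point of \<open>cantor_set\<close> contains a cylinder, whose mass is a product of positive
  weights.\<close>

lemma measure_supp_eq: "measure_supp limit_measure = cantor_set"
proof
  interpret lim: real_distribution limit_measure by (rule real_distribution_limit_measure)
  show "measure_supp limit_measure \<subseteq> cantor_set"
  proof (rule subsetI, rule ccontr)
    fix y assume y: "y \<in> measure_supp limit_measure" "y \<notin> cantor_set"
    then obtain k where k: "y \<notin> (\<Union>J\<in>(\<Pi>\<^sub>E i\<in>{..<k}. {..<n i}). cylinder J k)"
      by (auto simp: cantor_set_def)
    define U where "U = - (\<Union>J\<in>(\<Pi>\<^sub>E i\<in>{..<k}. {..<n i}). cylinder J k)"
    have "open U" unfolding U_def using closed_cylinder_union by (rule open_Compl)
    have "y \<in> U" unfolding U_def using k by blast
    with \<open>open U\<close> have "0 < emeasure limit_measure U" using y(1) by (auto simp: measure_supp_def)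
    moreover have "measure limit_measure U = measure limit_measure (U \<inter> cantor_set)"
      using \<open>open U\<close> by (intro measure_cantor_set_Int[symmetric]) auto
    moreover have "U \<inter> cantor_set = {}" unfolding U_def cantor_set_def by blast
    ultimately show False by (simp add: lim.emeasure_eq_measure)
  qed
  show "cantor_set \<subseteq> measure_supp limit_measure"
    unfolding measure_supp_def
  proof safe
    fix y U assume y: "y \<in> cantor_set" and U: "open U" "y \<in> U"
    then obtain r where r: "0 < r" "ball y r \<subseteq> U" by (meson openE)
    obtain k where k: "L k < r"
      using order_tendstoD(2)[OF L_lim r(1)] by (auto simp: eventually_sequentially)
    obtain J where J: "\<And>i. i < k \<Longrightarrow> J i < n i" "y \<in> cylinder J k"
      using mem_cantor_setE[OF y] by blast
    have "0 < (\<Prod>i<k. p (J i) i)" using J(1) p_pos by (intro prod_pos) auto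
    also have "\<dots> = measure limit_measure (cylinder J k)" using measure_cylinder[OF J(1)] by simp
    also have "\<dots> \<le> measure limit_measure U"
    proof (rule lim.finite_measure_mono)
      have "cylinder J k \<subseteq> ball y r"
        using J(2) k by (auto simp: cylinder_def dist_real_def)
      with r(2) show "cylinder J k \<subseteq> U" by blast
    qed (use U(1) in auto)
    finally show "0 < emeasure limit_measure U" by (simp add: lim.emeasure_eq_measure)
  qed
qed

lemma measure_limit_measure_interval: "measure limit_measure {0..L 0} = 1"
proof -
  interpret lim: real_distribution limit_measure by (rule real_distribution_limit_measure)
  have "AE y in limit_measure. y \<in> {0..L 0}"
    using AE_cantor_set
  proof eventually_elim
    case (elim y)
    then show ?case using mem_cantor_setE[OF elim, of 0] by (auto simp: cylinder_def left_end_def)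
  qed
  then show ?thesis by (intro lim.prob_eq_1[THEN iffD2]) auto
qed

section \<open>Partial convolutions and characteristic functions\<close>

text \<open>The index shift in the assumption arises because \<open>conv_upto\<close> begins with
  \<open>\<nu> 1\<close> while stages are counted from 0.\<close>

lemma distr_partial_sum:
  assumes "\<And>k. \<nu> (Suc k) = stage k"
  shows "conv_upto \<nu> k = distr (PiM UNIV stage) borel (\<lambda>\<omega>. \<Sum>i<k. \<omega> i)"
proof (induction k)
  case 0
  show ?case by (simp add: seq.distr_const)
next
  case (Suc k)
  have "seq.indep_var borel (\<lambda>\<omega>. \<omega> k) borel (\<lambda>\<omega>. \<Sum>i<k. \<omega> i)"
    by (intro seq.indep_vars_sum indep_vars_PiM_coordinates prob_space_stage) auto
  from seq.sum_indep_random_variable[OF this]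
  have "distr (PiM UNIV stage) borel (\<lambda>\<omega>. \<omega> k + (\<Sum>i<k. \<omega> i))
      = convolution (stage k) (distr (PiM UNIV stage) borel (\<lambda>\<omega>. \<Sum>i<k. \<omega> i))"
    by (simp add: distr_coordinate)
  also have "\<dots> = convolution (distr (PiM UNIV stage) borel (\<lambda>\<omega>. \<Sum>i<k. \<omega> i)) (stage k)"
    by (intro convolution_commutative prob_space.finite_measure prob_space_stage seq.prob_space_distr) auto
  finally show ?case
    using Suc by (simp add: assms add.commute)
qed

lemma char_partial_sum:
  "char (distr (PiM UNIV stage) borel (\<lambda>\<omega>. \<Sum>i<k. \<omega> i)) t = (\<Prod>i<k. char (stage i) t)"
proof (cases "k = 0")
  case True
  then show ?thesis
    by (simp add: seq.distr_const char_def integral_return)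
next
  case False
  then show ?thesis
    by (subst seq.char_distr_sum[OF indep_vars_PiM_coordinates])
      (auto simp: prob_space_stage distr_coordinate)
qed

text \<open>Dominated convergence with bound 1, since the partial sums converge almost surely. This
  gives the weak limit by Levy's theorem and also the product bound on the limit.\<close>

lemma char_partial_sum_tendsto:
  "(\<lambda>k. char (distr (PiM UNIV stage) borel (\<lambda>\<omega>. \<Sum>i<k. \<omega> i)) t) \<longlonglongrightarrow> char limit_measure t"
proof -
  have "(\<lambda>k. CLINT \<omega>|PiM UNIV stage. iexp (t * (\<Sum>i<k. \<omega> i)))
      \<longlonglongrightarrow> (CLINT \<omega>|PiM UNIV stage. iexp (t * (\<Sum>k. \<omega> k)))"
  proof (rule integral_dominated_convergence[where w = "\<lambda>_. 1"])
    show "AE \<omega> in PiM UNIV stage. (\<lambda>k. iexp (t * (\<Sum>i<k. \<omega> i))) \<longlonglongrightarrow> iexp (t * (\<Sum>k. \<omega> k))"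
      using AE_digits
    proof eventually_elim
      case (elim \<omega>)
      then obtain I where I: "\<And>i. I i < n i" "\<And>i. \<omega> i = x (I i) i" by auto
      have "(\<lambda>k. \<Sum>i<k. \<omega> i) \<longlonglongrightarrow> (\<Sum>k. \<omega> k)"
        using digits_sums(1)[OF I(1)] I(2) by (simp add: left_end_def[abs_def])
      then show ?case by (intro tendsto_intros)
    qed
  qed (auto simp del: of_real_mult of_real_sum)
  then show ?thesis
    unfolding char_def limit_measure_def by (simp add: integral_distr del: of_real_mult of_real_sum)
qed

lemma weak_conv_limit_measure:
  assumes "\<And>k. \<nu> (Suc k) = stage k"
  shows "weak_conv_m (conv_upto \<nu>) limit_measure"
proof (rule levy_continuity)
  show "real_distribution (conv_upto \<nu> k)" for k
    unfolding distr_partial_sum[OF assms] by (intro seq.real_distribution_distr) measurable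
qed (simp_all add: real_distribution_limit_measure distr_partial_sum[OF assms] char_partial_sum_tendsto)

text \<open>All factors outside \<open>I\<close> have modulus at most 1, and the bound survives the
  limit. The choice of \<open>I\<close> allows the stages too fine for a given frequency to be
  dropped.\<close>

lemma cmod_char_limit_measure_le:
  assumes "finite I"
  shows "cmod (char limit_measure t) \<le> (\<Prod>i\<in>I. cmod (char (stage i) t))"
proof (rule LIMSEQ_le_const2)
  show "(\<lambda>k. cmod (\<Prod>i<k. char (stage i) t)) \<longlonglongrightarrow> cmod (char limit_measure t)"
    using tendsto_norm[OF char_partial_sum_tendsto] by (simp add: char_partial_sum)
  obtain m where m: "I \<subseteq> {..<m}" using assms finite_nat_bounded by blast
  have "cmod (\<Prod>i<k. char (stage i) t) \<le> (\<Prod>i\<in>I. cmod (char (stage i) t))" if "m \<le> k" for k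
  proof -
    have "I \<subseteq> {..<k}" using m that by auto
    then have "cmod (\<Prod>i<k. char (stage i) t)
        = (\<Prod>i\<in>{..<k} - I. cmod (char (stage i) t)) * (\<Prod>i\<in>I. cmod (char (stage i) t))"
      by (simp add: prod_norm prod.subset_diff norm_mult)
    also have "\<dots> \<le> 1 * (\<Prod>i\<in>I. cmod (char (stage i) t))"
      by (intro mult_right_mono prod_le_1 prod_nonneg)
        (auto intro: real_distribution.cmod_char_le_1 real_distribution_stage)
    finally show ?thesis by simp
  qed
  then show "\<exists>N. \<forall>k\<ge>N. cmod (\<Prod>i<k. char (stage i) t) \<le> (\<Prod>i\<in>I. cmod (char (stage i) t))"
    by blast
qed

end

section \<open>Hausdorff measure\<close>

text \<open>Let \<open>r\<close> tend to 0. This deals with covering sets of diameter 0, whose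
  \<open>diam_power\<close> vanishes for positive \<open>t\<close>.\<close>

lemma measure_singleton_eq_0_if_ball_le:
  fixes M :: "'a::metric_space measure"
  assumes "prob_space M" "sets M = sets borel" "0 < t"
    and "\<And>r. 0 < r \<Longrightarrow> r \<le> 1 \<Longrightarrow> measure M (ball a r) \<le> C * r powr t"
  shows "measure M {a} = 0"
proof -
  interpret prob_space M by fact
  have "((\<lambda>r. C * r powr t) \<longlongrightarrow> C * 0 powr t) (at_right 0)"
    using \<open>0 < t\<close> by (intro tendsto_intros tendsto_powr2) (auto simp: eventually_at_filter)
  moreover have "eventually (\<lambda>r. measure M {a} \<le> C * r powr t) (at_right 0)"
    using eventually_at_right_real[OF zero_less_one]
  proof eventually_elim
    case (elim r)
    have "measure M {a} \<le> measure M (ball a r)"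
      using elim by (intro finite_measure_mono) (auto simp: assms(2))
    also have "\<dots> \<le> C * r powr t" using elim by (intro assms(4)) auto
    finally show ?case .
  qed
  ultimately have "measure M {a} \<le> C * 0 powr t"
    by (rule tendsto_lowerbound) simp
  then show ?thesis by (simp add: measure_le_0_iff)
qed

text \<open>The mass distribution principle: the mass of a covering set is at most a constant times
  \<open>diam_power\<close>, so no cover of a set of mass 1 can have an arbitrarily small
  sum.\<close>

lemma hausdorff_measure_nonzero_if_ball_le:
  fixes M :: "'a::metric_space measure"
  assumes M: "prob_space M" "sets M = sets borel"
    and E: "E \<in> sets borel" "measure M E = 1" and t: "0 \<le> t"
    and ball: "\<And>a r. a \<in> E \<Longrightarrow> 0 < r \<Longrightarrow> r \<le> 1 \<Longrightarrow> measure M (ball a r) \<le> C * r powr t"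
  shows "hausdorff_measure t E \<noteq> 0"
proof
  interpret prob_space M by fact
  define c where "c = max C 1 * 2 powr t"
  have c: "0 < c" by (simp add: c_def)
  \<comment> \<open>Covering sets may fail to be measurable, so \<open>U\<close> is replaced by a
    ball of radius \<open>2 * diameter U\<close> about one of its points in \<open>E\<close>.
    Diameter at most \<open>1/2\<close> keeps this radius in the range of the hypothesis on
    balls.\<close>
  have local: "\<exists>V\<in>sets M. U \<inter> E \<subseteq> V \<and> emeasure M V \<le> ennreal c * diam_power t U"
    if U: "bounded U" "diameter U \<le> 1/2" for U
  proof (cases "U \<inter> E = {}")
    case False
    then obtain a where a: "a \<in> U" "a \<in> E" by blast
    have dist: "dist a b \<le> diameter U" if "b \<in> U" for b
      using diameter_bounded_bound[OF U(1) a(1) that] .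
    have "1 \<le> c" using mult_mono[of 1 "max C 1" 1 "2 powr t"] ge_one_powr_ge_zero[of 2 t] t
      by (simp add: c_def)
    \<comment> \<open>For \<open>t = 0\<close> the value \<open>diam_power t U = 1\<close> pays for
      the whole space; for diameter 0 the open ball above would be empty.\<close>
    consider "t = 0" | "0 < t" "diameter U = 0" | "0 < t" "0 < diameter U"
      using t diameter_ge_0[OF U(1)] by force
    then show ?thesis
    proof cases
      case 1
      then show ?thesis
        using \<open>1 \<le> c\<close> a emeasure_space_1 sets.sets_into_space[of E M] E(1) M(2)
        by (intro bexI[of _ "space M"]) (auto simp: diam_power_def)
    next
      case 2
      then have "U \<inter> E \<subseteq> {a}" using dist by fastforce
      moreover have "measure M {a} = 0"
        using measure_singleton_eq_0_if_ball_le[OF M 2(1) ball[OF a(2)]] .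
      ultimately show ?thesis
        by (intro bexI[of _ "{a}"]) (auto simp: emeasure_eq_measure M(2))
    next
      case 3
      have "measure M (ball a (2 * diameter U)) \<le> C * (2 * diameter U) powr t"
        using 3 U(2) by (intro ball a) auto
      also have "\<dots> \<le> max C 1 * (2 * diameter U) powr t"
        by (intro mult_right_mono) auto
      also have "\<dots> = c * diameter U powr t"
        using 3 by (simp add: c_def powr_mult)
      finally have "emeasure M (ball a (2 * diameter U)) \<le> ennreal c * diam_power t U"
        using 3 a c by (auto simp: emeasure_eq_measure diam_power_def ennreal_mult[symmetric])
      moreover have "U \<inter> E \<subseteq> ball a (2 * diameter U)"
        using dist 3 by fastforce
      ultimately show ?thesis
        by (intro bexI[of _ "ball a (2 * diameter U)"]) (auto simp: M(2))
    qed
  qed (auto intro!: bexI[of _ "{}"])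
  assume "hausdorff_measure t E = 0"
  then have "hausdorff_premeasure t (1/2) E \<le> 0"
    unfolding hausdorff_measure_def
    by (metis SUP_upper greaterThan_iff half_gt_zero_iff zero_less_one)
  then have "hausdorff_premeasure t (1/2) E < ennreal (1 / (2 * c))"
    using c by (simp add: le_less_trans ennreal_zero_less_divide)
  then obtain U where U: "E \<subseteq> (\<Union>i. U i)" "\<And>i::nat. bounded (U i) \<and> diameter (U i) \<le> 1/2"
    and small: "(\<Sum>i. diam_power t (U i)) < ennreal (1 / (2 * c))"
    unfolding hausdorff_premeasure_def INF_less_iff by auto
  have "\<forall>i. \<exists>V. V \<in> sets M \<and> U i \<inter> E \<subseteq> V \<and> emeasure M V \<le> ennreal c * diam_power t (U i)"
    using local U(2) by blast
  then obtain V where V: "\<And>i. V i \<in> sets M" "\<And>i. U i \<inter> E \<subseteq> V i"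
    "\<And>i. emeasure M (V i) \<le> ennreal c * diam_power t (U i)"
    by metis
  have "1 = emeasure M E" using E by (simp add: emeasure_eq_measure)
  also have "\<dots> \<le> emeasure M (\<Union>i. V i)"
  proof (rule emeasure_mono)
    show "E \<subseteq> (\<Union>i. V i)" using U(1) V(2) by blast
  qed (use V(1) in auto)
  also have "\<dots> \<le> (\<Sum>i. emeasure M (V i))"
    using V(1) by (intro emeasure_subadditive_countably) auto
  also have "\<dots> \<le> (\<Sum>i. ennreal c * diam_power t (U i))"
    using V(3) by (intro suminf_le) auto
  also have "\<dots> = ennreal c * (\<Sum>i. diam_power t (U i))" by simp
  also have "\<dots> \<le> ennreal c * ennreal (1 / (2 * c))"
    using small by (intro mult_left_mono) auto
  also have "\<dots> = ennreal (1/2)" using c by (simp add: ennreal_mult[symmetric])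
  also have "\<dots> < ennreal 1" by (rule ennreal_lessI) auto
  finally show False by simp
qed

lemma hausdorff_measure_eq_0_if_covers:
  fixes E :: "'a::metric_space set" and A :: "nat \<Rightarrow> 'b \<Rightarrow> 'a set"
  assumes t: "0 < t" and fin: "\<And>k. finite (I k)" and cover: "\<And>k. E \<subseteq> (\<Union>i\<in>I k. A k i)"
    and A: "\<And>k i. i \<in> I k \<Longrightarrow> bounded (A k i)" "\<And>k i. i \<in> I k \<Longrightarrow> diameter (A k i) \<le> L k"
    and L: "L \<longlonglongrightarrow> 0" and lim: "(\<lambda>k. real (card (I k)) * L k powr t) \<longlonglongrightarrow> 0"
  shows "hausdorff_measure t E = 0"
proof -
  have "hausdorff_premeasure t \<delta> E \<le> 0" if "0 < \<delta>" for \<delta>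
  proof (rule ennreal_le_epsilon)
    fix e :: real assume "0 < e"
    have "eventually (\<lambda>k. L k < \<delta> \<and> real (card (I k)) * L k powr t < e) sequentially"
      using order_tendstoD(2)[OF L that] order_tendstoD(2)[OF lim \<open>0 < e\<close>] by eventually_elim simp
    then obtain k where k: "L k < \<delta>" "real (card (I k)) * L k powr t < e"
      by (auto simp: eventually_sequentially)
    obtain h where h: "bij_betw h {..<card (I k)} (I k)"
      using ex_bij_betw_nat_finite[OF fin, of k] by (auto simp: atLeast0LessThan)
    \<comment> \<open>The finite cover is padded to a sequence by empty sets, which have
      \<open>diam_power\<close> 0.\<close>
    define U where "U i = (if i < card (I k) then A k (h i) else {})" for i
    have hI: "h i \<in> I k" if "i < card (I k)" for i
      using h that by (auto simp: bij_betw_def)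
    have "E \<subseteq> (\<Union>i. U i)"
    proof
      fix y assume "y \<in> E"
      then obtain j where "j \<in> I k" "y \<in> A k j" using cover by blast
      moreover then obtain i where "i < card (I k)" "j = h i"
        using h by (auto simp: bij_betw_def)
      ultimately show "y \<in> (\<Union>i. U i)" unfolding U_def by auto
    qed
    moreover have "\<forall>i. bounded (U i) \<and> diameter (U i) \<le> \<delta>"
      using A hI k(1) that by (force simp: U_def)
    ultimately have "hausdorff_premeasure t \<delta> E \<le> (\<Sum>i. diam_power t (U i))"
      unfolding hausdorff_premeasure_def by (intro INF_lower) auto
    also have "\<dots> = (\<Sum>i<card (I k). diam_power t (U i))"
      by (intro suminf_finite) (auto simp: U_def diam_power_def)
    also have "\<dots> \<le> (\<Sum>i<card (I k). ennreal (L k powr t))"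
    proof (rule sum_mono)
      fix i assume "i \<in> {..<card (I k)}"
      then have "bounded (U i)" "diameter (U i) \<le> L k" using A hI by (auto simp: U_def)
      then show "diam_power t (U i) \<le> ennreal (L k powr t)"
        using t by (auto simp: diam_power_def intro!: ennreal_leI powr_mono2 diameter_ge_0)
    qed
    also have "\<dots> = ennreal (real (card (I k)) * L k powr t)"
      by (simp add: ennreal_mult ennreal_of_nat_eq_real_of_nat)
    also have "\<dots> \<le> 0 + ennreal e" using k(2) by (simp add: ennreal_leI)
    finally show "hausdorff_premeasure t \<delta> E \<le> 0 + ennreal e" .
  qed
  then show ?thesis
    unfolding hausdorff_measure_def by (simp add: SUP_eq_const flip: le_zero_eq) (auto intro: SUP_least)
qed

section \<open>Exponential sums with random jitter\<close>

abbreviation uniform_sequence :: "(nat \<Rightarrow> real) measure" where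
  "uniform_sequence \<equiv> PiM UNIV (\<lambda>_. uniform_measure lborel {0..1})"

lemma prob_space_uniform_01: "prob_space (uniform_measure lborel {0..1::real})"
  by (rule prob_space_uniform_measure) auto

lemma prob_space_uniform_sequence: "prob_space uniform_sequence"
  by (rule prob_space_PiM) (rule prob_space_uniform_01)

lemma measurable_uniform_sequence_coordinate [measurable]:
  "(\<lambda>\<omega>. \<omega> i) \<in> borel_measurable uniform_sequence"
  using measurable_component_singleton[of i UNIV "\<lambda>_. uniform_measure lborel {0..1::real}"]
  by (simp cong: measurable_cong_sets)

lemma distr_uniform_sequence_coordinate:
  "distr uniform_sequence borel (\<lambda>\<omega>. \<omega> i) = uniform_measure lborel {0..1}"
proof -
  interpret product_prob_space "\<lambda>_::nat. uniform_measure lborel {0..1::real}" UNIV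
    using prob_space_uniform_01 by (rule product_prob_spaceI)
  show ?thesis using PiM_component[of i] by (simp cong: distr_cong)
qed

text \<open>The antiderivative is a sine divided by \<open>c\<close>. This is how the jitter
  averages a frequency away; the phase \<open>a\<close> lets one estimate serve real and imaginary
  parts.\<close>

lemma integral_uniform_cos:
  fixes a c :: real
  assumes "0 < c"
  shows "\<bar>integral\<^sup>L (uniform_measure lborel {0..1}) (\<lambda>u. cos (a + c * u))\<bar> \<le> 2 / c"
proof -
  have "uniform_measure lborel {0..1} = density lborel (\<lambda>u::real. ennreal (indicator {0..1} u))"
    by (simp add: uniform_measure_def divide_ennreal_def ennreal_indicator)
  then have "integral\<^sup>L (uniform_measure lborel {0..1}) (\<lambda>u. cos (a + c * u))
      = (LBINT u. cos (a + c * u) * indicator {0..1} u)"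
    by (simp add: integral_density mult.commute)
  also have "\<dots> = sin (a + c * 1) / c - sin (a + c * 0) / c"
    using assms
    by (intro integral_FTC_Icc_real)
      (auto intro!: derivative_eq_intros continuous_intros)
  also have "\<bar>\<dots>\<bar> \<le> 2 / c"
  proof -
    have "\<bar>sin (a + c) - sin a\<bar> \<le> 2"
      using abs_sin_le_one[of "a + c"] abs_sin_le_one[of a] by linarith
    then show ?thesis
      using assms by (simp add: diff_divide_distrib[symmetric] divide_right_mono)
  qed
  finally show ?thesis .
qed

text \<open>Hoeffding's inequality about the mean, which accounts for \<open>2 / c\<close>. The
  summands range over \<open>{- p j..p j}\<close>, and \<open>p j \<le> 2 / real N\<close> bounds
  the sum of squared ranges by \<open>16 / real N\<close>; this yields the exponent
  \<open>T\<^sup>2 / 8\<close>.\<close>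

lemma cos_sum_deviation:
  fixes p a :: "nat \<Rightarrow> real"
  assumes p: "\<And>j. j < N \<Longrightarrow> 0 \<le> p j" "\<And>j. j < N \<Longrightarrow> p j \<le> 2 / real N" "(\<Sum>j<N. p j) = 1"
    and c: "0 < c" and T: "0 \<le> T"
  shows "measure uniform_sequence {\<omega> \<in> space uniform_sequence.
      T / sqrt (real N) + 2 / c \<le> \<bar>\<Sum>j<N. p j * cos (a j + c * \<omega> j)\<bar>} \<le> 2 * exp (- T\<^sup>2 / 8)"
proof -
  interpret prob_space uniform_sequence by (rule prob_space_uniform_sequence)
  have N: "0 < N" using p(3) by (cases N) auto
  define X where "X j \<omega> = p j * cos (a j + c * \<omega> j)" for j and \<omega> :: "nat \<Rightarrow> real"
  define m where "m = (\<Sum>j<N. expectation (X j))"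
  have "indep_vars (\<lambda>_. borel) (\<lambda>i \<omega>. \<omega> i) {..<N}"
    using N by (intro indep_vars_PiM_coordinates prob_space_uniform_01) auto
  then have indep: "indep_vars (\<lambda>_. borel) X {..<N}"
    unfolding X_def by (rule indep_vars_compose2) auto
  interpret Hoeffding_ineq uniform_sequence "{..<N}" X "\<lambda>j. - p j" p m
  proof unfold_locales
    show "AE \<omega> in uniform_sequence. X j \<omega> \<in> {- p j..p j}" if "j \<in> {..<N}" for j
    proof (rule AE_I2)
      fix \<omega>
      have "\<bar>p j * cos (a j + c * \<omega> j)\<bar> \<le> p j * 1"
        unfolding abs_mult using p(1)[of j] that by (intro mult_mono) auto
      then show "X j \<omega> \<in> {- p j..p j}" by (auto simp: X_def abs_le_iff)
    qed
  qed (use indep in \<open>auto simp: m_def\<close>)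
  have EX: "\<bar>expectation (X j)\<bar> \<le> p j * (2 / c)" if "j < N" for j
  proof -
    have "expectation (X j) = p j * expectation (\<lambda>\<omega>. cos (a j + c * \<omega> j))"
      unfolding X_def[abs_def] by simp
    also have "expectation (\<lambda>\<omega>. cos (a j + c * \<omega> j))
        = integral\<^sup>L (distr uniform_sequence borel (\<lambda>\<omega>. \<omega> j)) (\<lambda>u. cos (a j + c * u))"
      by (subst integral_distr) auto
    finally show ?thesis
      using mult_left_mono[OF integral_uniform_cos[OF c, of "a j"] p(1)[OF that]] p(1)[OF that]
      by (simp add: distr_uniform_sequence_coordinate abs_mult)
  qed
  have m: "\<bar>m\<bar> \<le> 2 / c"
  proof -
    have "\<bar>m\<bar> \<le> (\<Sum>j<N. p j * (2 / c))"
      unfolding m_def using EX by (intro order_trans[OF sum_abs] sum_mono) auto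
    also have "\<dots> = 2 / c" unfolding sum_distrib_right[symmetric] p(3) by simp
    finally show ?thesis .
  qed
  have "(\<Sum>j<N. (p j - - p j)\<^sup>2) \<le> (\<Sum>j<N. (4 / real N)\<^sup>2)"
    using p by (intro sum_mono power_mono) (auto simp: field_simps)
  also have "\<dots> = 16 / real N" using N by (simp add: power2_eq_square)
  finally have var: "(\<Sum>j<N. (p j - - p j)\<^sup>2) \<le> 16 / real N" .
  have pos: "0 < (\<Sum>j<N. (p j - - p j)\<^sup>2)"
  proof (rule ccontr)
    assume "\<not> ?thesis"
    moreover have "0 \<le> (\<Sum>j<N. (p j - - p j)\<^sup>2)" by (intro sum_nonneg) auto
    ultimately have "(\<Sum>j<N. (p j - - p j)\<^sup>2) = 0" by linarith
    then have "\<forall>j<N. p j = 0" by (subst (asm) sum_nonneg_eq_0_iff) auto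
    then show False using p(3) by simp
  qed
  have "prob {\<omega> \<in> space uniform_sequence.
      T / sqrt (real N) + 2 / c \<le> \<bar>\<Sum>j<N. p j * cos (a j + c * \<omega> j)\<bar>}
     \<le> prob {\<omega> \<in> space uniform_sequence. T / sqrt (real N) \<le> \<bar>(\<Sum>j<N. X j \<omega>) - m\<bar>}"
    using m by (intro finite_measure_mono) (auto simp: X_def)
  also have "\<dots> \<le> 2 * exp (- 2 * (T / sqrt (real N))\<^sup>2 / (\<Sum>j<N. (p j - - p j)\<^sup>2))"
    using T pos by (intro Hoeffding_ineq_abs_ge) auto
  also have "\<dots> \<le> 2 * exp (- T\<^sup>2 / 8)"
  proof -
    have "T\<^sup>2 / 8 = 2 * (T\<^sup>2 / real N) / (16 / real N)" using N by simp
    also have "\<dots> \<le> 2 * (T\<^sup>2 / real N) / (\<Sum>j<N. (p j - - p j)\<^sup>2)"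
      using var pos N by (intro divide_left_mono) simp_all
    finally show ?thesis using N by (simp add: power_divide)
  qed
  finally show ?thesis .
qed

text \<open>Union bound over \<open>G\<close> and the phases 0 and \<open>pi / 2\<close>, which give
  real and imaginary parts. The factor 4 is two phases times the 2 of the two-sided Hoeffding
  bound.\<close>

lemma exists_jitter_finite:
  fixes p b :: "nat \<Rightarrow> real"
  assumes p: "\<And>j. j < N \<Longrightarrow> 0 \<le> p j" "\<And>j. j < N \<Longrightarrow> p j \<le> 2 / real N" "(\<Sum>j<N. p j) = 1"
    and l: "0 < l" and T: "0 \<le> T"
    and G: "finite G" "\<And>t. t \<in> G \<Longrightarrow> 0 < t" "real (card G) * (4 * exp (- T\<^sup>2 / 8)) < 1"
  obtains u where "\<And>j. 0 \<le> u j \<and> u j \<le> 1"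
    "\<And>t. t \<in> G \<Longrightarrow>
       cmod (\<Sum>j<N. p j *\<^sub>R iexp (t * (b j + u j * l))) \<le> 2 * T / sqrt (real N) + 4 / (t * l)"
proof -
  interpret prob_space uniform_sequence by (rule prob_space_uniform_sequence)
  define A where "A a t = {\<omega> \<in> space uniform_sequence. T / sqrt (real N) + 2 / (t * l)
     \<le> \<bar>\<Sum>j<N. p j * cos ((t * b j - a) + (t * l) * \<omega> j)\<bar>}" for a t
  have A [measurable]: "A a t \<in> events" for a t
    unfolding A_def by measurable
  have A_le: "prob (A a t) \<le> 2 * exp (- T\<^sup>2 / 8)" if "t \<in> G" for a t
    unfolding A_def by (rule cos_sum_deviation) (use p l T G(2)[OF that] in auto)
  have "prob (\<Union>t\<in>G. A 0 t \<union> A (pi / 2) t) \<le> (\<Sum>t\<in>G. prob (A 0 t \<union> A (pi / 2) t))"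
    using G(1) by (intro finite_measure_subadditive_finite) auto
  also have "\<dots> \<le> (\<Sum>t\<in>G. 4 * exp (- T\<^sup>2 / 8))"
  proof (rule sum_mono)
    fix t assume "t \<in> G"
    then show "prob (A 0 t \<union> A (pi / 2) t) \<le> 4 * exp (- T\<^sup>2 / 8)"
      using measure_Un_le[OF A A, of 0 t "pi / 2" t] A_le[of t 0] A_le[of t "pi/2"] by linarith
  qed
  also have "\<dots> < 1" using G(3) by simp
  finally have lt: "prob (\<Union>t\<in>G. A 0 t \<union> A (pi / 2) t) < 1" .
  \<comment> \<open>The underlying space contains all real sequences, so the range of the jitter is
    an almost sure property and has to be combined with the avoidance of the bad events.\<close>
  have 01: "AE \<omega> in uniform_sequence. \<forall>j. 0 \<le> \<omega> j \<and> \<omega> j \<le> 1"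
  proof (subst AE_all_countable, rule allI, rule AE_PiM_component)
    show "AE y in uniform_measure lborel {0..1}. 0 \<le> y \<and> y \<le> (1::real)"
      by (rule AE_uniform_measureI) auto
  qed (auto simp: prob_space_uniform_01)
  have "\<exists>\<omega>\<in>space uniform_sequence.
      (\<forall>j. 0 \<le> \<omega> j \<and> \<omega> j \<le> 1) \<and> \<omega> \<notin> (\<Union>t\<in>G. A 0 t \<union> A (pi / 2) t)"
  proof (rule ccontr)
    assume none: "\<not> ?thesis"
    have "AE \<omega> in uniform_sequence. \<omega> \<in> (\<Union>t\<in>G. A 0 t \<union> A (pi / 2) t)"
      using 01 AE_space
    proof eventually_elim
      case (elim \<omega>)
      then show ?case using none by blast
    qed
    then have "prob (\<Union>t\<in>G. A 0 t \<union> A (pi / 2) t) = 1"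
      using G(1) by (intro prob_eq_1[THEN iffD2]) auto
    with lt show False by simp
  qed
  then obtain u where sp: "u \<in> space uniform_sequence" and u: "\<And>j. 0 \<le> u j \<and> u j \<le> 1"
    "u \<notin> (\<Union>t\<in>G. A 0 t \<union> A (pi / 2) t)"
    by blast
  show thesis
  proof (rule that[of u])
    fix t assume t: "t \<in> G"
    let ?z = "\<Sum>j<N. p j *\<^sub>R iexp (t * (b j + u j * l))"
    have "Re ?z = (\<Sum>j<N. p j * cos ((t * b j - 0) + (t * l) * u j))"
      by (simp add: Re_sum Re_exp algebra_simps)
    moreover have "Im ?z = (\<Sum>j<N. p j * cos ((t * b j - pi / 2) + (t * l) * u j))"
    proof -
      have "cos ((t * b j - pi / 2) + (t * l) * u j) = sin (t * (b j + u j * l))" for j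
      proof -
        have "(t * b j - pi / 2) + (t * l) * u j = - (pi / 2 - t * (b j + u j * l))"
          by (simp add: algebra_simps)
        then show ?thesis by (simp only: cos_minus sin_cos_eq of_real_eq_id id_apply)
      qed
      then show ?thesis by (simp add: Im_sum Im_exp)
    qed
    moreover have "u \<notin> A 0 t" "u \<notin> A (pi / 2) t" using u(2) t by auto
    ultimately have less: "\<bar>Re ?z\<bar> < T / sqrt (real N) + 2 / (t * l)"
      "\<bar>Im ?z\<bar> < T / sqrt (real N) + 2 / (t * l)"
      using sp by (simp_all only: A_def mem_Collect_eq not_le simp_thms)
    then show "cmod ?z \<le> 2 * T / sqrt (real N) + 4 / (t * l)"
    proof -
      have "2 * T / sqrt (real N) + 4 / (t * l) = 2 * (T / sqrt (real N) + 2 / (t * l))" by simp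
      with less show ?thesis using cmod_le[of ?z] by linarith
    qed
  qed (use u in auto)
qed

lemma cmod_iexp_diff_le: "cmod (iexp a - iexp b) \<le> \<bar>a - b\<bar>"
proof -
  have "iexp a - iexp b = iexp b * (iexp (a - b) - 1)"
    by (simp add: algebra_simps exp_add[symmetric])
  then have "cmod (iexp a - iexp b) = cmod (iexp (a - b) - 1)"
    by (simp add: norm_mult del: of_real_diff)
  also have "\<dots> \<le> \<bar>a - b\<bar>"
    using iexp_approx1[of "a - b" 0] by (simp del: of_real_diff)
  finally show ?thesis .
qed

lemma cmod_iexp_sum_diff_le:
  fixes p y :: "nat \<Rightarrow> real"
  assumes p: "\<And>j. j < N \<Longrightarrow> 0 \<le> p j" "(\<Sum>j<N. p j) = 1" and y: "\<And>j. j < N \<Longrightarrow> \<bar>y j\<bar> \<le> 1"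
  shows "cmod ((\<Sum>j<N. p j *\<^sub>R iexp (t * y j)) - (\<Sum>j<N. p j *\<^sub>R iexp (t' * y j))) \<le> \<bar>t - t'\<bar>"
proof -
  have "cmod ((\<Sum>j<N. p j *\<^sub>R iexp (t * y j)) - (\<Sum>j<N. p j *\<^sub>R iexp (t' * y j)))
      = cmod (\<Sum>j<N. p j *\<^sub>R (iexp (t * y j) - iexp (t' * y j)))"
    by (simp add: sum_subtractf scaleR_diff_right)
  also have "\<dots> \<le> (\<Sum>j<N. p j * \<bar>t - t'\<bar>)"
  proof (rule sum_norm_le)
    fix j assume "j \<in> {..<N}"
    then have j: "j < N" by simp
    have "cmod (iexp (t * y j) - iexp (t' * y j)) \<le> \<bar>t - t'\<bar> * \<bar>y j\<bar>"
      using cmod_iexp_diff_le[of "t * y j" "t' * y j"]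
      by (simp add: left_diff_distrib[symmetric] abs_mult)
    also have "\<dots> \<le> \<bar>t - t'\<bar> * 1" using y[OF j] by (intro mult_left_mono) auto
    finally show "norm (p j *\<^sub>R (iexp (t * y j) - iexp (t' * y j))) \<le> p j * \<bar>t - t'\<bar>"
      using p(1)[OF j] by (simp add: mult_left_mono)
  qed
  also have "\<dots> = \<bar>t - t'\<bar>" using p(2) by (simp add: sum_distrib_right[symmetric])
  finally show ?thesis .
qed

text \<open>Discretising the frequencies with mesh \<open>\<delta>\<close> costs an error \<open>\<delta>\<close> because the
  exponential sum is 1-Lipschitz.\<close>

lemma exists_jitter:
  fixes p b :: "nat \<Rightarrow> real"
  assumes p: "\<And>j. j < N \<Longrightarrow> 0 \<le> p j" "\<And>j. j < N \<Longrightarrow> p j \<le> 2 / real N" "(\<Sum>j<N. p j) = 1"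
    and b: "\<And>j. j < N \<Longrightarrow> 0 \<le> b j" "\<And>j. j < N \<Longrightarrow> b j + l \<le> 1"
    and l: "0 < l" and T: "0 \<le> T" and \<delta>: "0 < \<delta>" and R: "0 \<le> R"
    and small: "(R / \<delta> + 1) * (4 * exp (- T\<^sup>2 / 8)) < 1"
  obtains u where "\<And>j. 0 \<le> u j \<and> u j \<le> 1"
    "\<And>t. t \<noteq> 0 \<Longrightarrow> \<bar>t\<bar> \<le> R \<Longrightarrow>
       cmod (\<Sum>j<N. p j *\<^sub>R iexp (t * (b j + u j * l)))
         \<le> 2 * T / sqrt (real N) + 4 / (\<bar>t\<bar> * l) + \<delta>"
proof -
  define G where "G = (\<lambda>m. \<delta> * real m) ` {1..nat \<lceil>R / \<delta>\<rceil>}"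
  have "card G \<le> nat \<lceil>R / \<delta>\<rceil>"
    unfolding G_def using card_image_le[of "{1..nat \<lceil>R / \<delta>\<rceil>}"] by simp
  then have "real (card G) \<le> R / \<delta> + 1"
    using R \<delta> by (smt (verit) of_nat_ceiling of_int_ceiling_le_add_one divide_nonneg_pos of_nat_mono real_nat_ceiling_ge of_nat_nat zero_le_ceiling)
  then have "real (card G) * (4 * exp (- T\<^sup>2 / 8)) < 1"
    by (intro le_less_trans[OF mult_right_mono small]) auto
  moreover have "finite G" "\<And>t. t \<in> G \<Longrightarrow> 0 < t"
    using \<delta> by (auto simp: G_def)
  ultimately obtain u where u: "\<And>j. 0 \<le> u j \<and> u j \<le> 1"
    "\<And>t. t \<in> G \<Longrightarrow>
       cmod (\<Sum>j<N. p j *\<^sub>R iexp (t * (b j + u j * l))) \<le> 2 * T / sqrt (real N) + 4 / (t * l)"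
    using exists_jitter_finite[OF p l T, of G b] by blast
  have y: "\<bar>b j + u j * l\<bar> \<le> 1" if "j < N" for j
  proof -
    have "0 \<le> u j * l" "u j * l \<le> 1 * l"
      using u(1)[of j] l by (auto intro: mult_right_mono)
    then show ?thesis using b[OF that] by simp
  qed
  define f where "f t = (\<Sum>j<N. p j *\<^sub>R iexp (t * (b j + u j * l)))" for t
  have pos: "cmod (f t) \<le> 2 * T / sqrt (real N) + 4 / (t * l) + \<delta>" if t: "0 < t" "t \<le> R" for t
  proof -
    \<comment> \<open>Rounding up gives a grid point that is positive and at least \<open>t\<close>,
      so its mean term is at most \<open>4 / (t * l)\<close>.\<close>
    define m where "m = nat \<lceil>t / \<delta>\<rceil>"
    have m: "t / \<delta> \<le> real m" "real m \<le> t / \<delta> + 1" "1 \<le> m"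
      using t \<delta> unfolding m_def by (auto intro: real_nat_ceiling_ge) (simp add: Suc_leI)
    have "m \<le> nat \<lceil>R / \<delta>\<rceil>"
      unfolding m_def using t \<delta> by (intro nat_mono ceiling_mono divide_right_mono) auto
    then have mG: "\<delta> * real m \<in> G" using m(3) by (auto simp: G_def)
    have tm: "t \<le> \<delta> * real m" "\<delta> * real m \<le> t + \<delta>"
      using m \<delta> by (auto simp: field_simps)
    have "cmod (f t) \<le> cmod (f (\<delta> * real m)) + cmod (f t - f (\<delta> * real m))"
      using norm_triangle_sub by blast
    also have "cmod (f t - f (\<delta> * real m)) \<le> \<bar>t - \<delta> * real m\<bar>"
      unfolding f_def using p y by (intro cmod_iexp_sum_diff_le) auto
    also have "\<dots> \<le> \<delta>" using tm by simp
    also have "cmod (f (\<delta> * real m)) \<le> 2 * T / sqrt (real N) + 4 / (\<delta> * real m * l)"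
      unfolding f_def using u(2)[OF mG] .
    also have "4 / (\<delta> * real m * l) \<le> 4 / (t * l)"
      using tm t l \<delta> m(3) by (intro divide_left_mono mult_right_mono mult_pos_pos) auto
    finally show ?thesis by simp
  qed
  \<comment> \<open>The grid is positive; negative frequencies follow by conjugation.\<close>
  have neg: "cmod (f (- t)) = cmod (f t)" for t
  proof -
    have "f (- t) = cnj (f t)"
      by (simp add: f_def exp_cnj)
    then show ?thesis by simp
  qed
  show thesis
  proof (rule that[of u])
    fix t :: real assume "t \<noteq> 0" "\<bar>t\<bar> \<le> R"
    then show "cmod (\<Sum>j<N. p j *\<^sub>R iexp (t * (b j + u j * l)))
         \<le> 2 * T / sqrt (real N) + 4 / (\<bar>t\<bar> * l) + \<delta>"
      using pos[of t] pos[of "- t"] neg[of t] unfolding f_def[symmetric] by (cases "0 < t") auto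
  qed (use u in auto)
qed

section \<open>Scales and weights\<close>

lemma hausdorff_dim_eqI:
  fixes E :: "'a::metric_space set"
  assumes "0 \<le> s" "\<And>t. s < t \<Longrightarrow> hausdorff_measure t E = 0"
    and "\<And>t. 0 \<le> t \<Longrightarrow> t < s \<Longrightarrow> hausdorff_measure t E \<noteq> 0"
  shows "hausdorff_dim E = ennreal s"
proof (rule antisym)
  show "hausdorff_dim E \<le> ennreal s"
  proof (rule ennreal_le_epsilon)
    fix e :: real assume "0 < e"
    then have "hausdorff_dim E \<le> ennreal (s + e)"
      unfolding hausdorff_dim_def using assms(1,2) by (intro Inf_lower CollectI exI[of _ "s + e"]) auto
    then show "hausdorff_dim E \<le> ennreal s + ennreal e"
      using \<open>0 < e\<close> assms(1) by (simp add: ennreal_plus)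
  qed
  show "ennreal s \<le> hausdorff_dim E"
    unfolding hausdorff_dim_def
  proof (rule Inf_greatest)
    fix z assume "z \<in> {ennreal t |t. 0 \<le> t \<and> hausdorff_measure t E = 0}"
    then obtain t where "z = ennreal t" "0 \<le> t" "hausdorff_measure t E = 0" by blast
    with assms(3)[of t] show "ennreal s \<le> z" by (cases "t < s") (auto intro: ennreal_leI)
  qed
qed

text \<open>After \<open>k\<close> stages there are \<open>2 powr (k * (k + 1) / 2)\<close> cells. Length \<open>2 powr - (k * (k + 1) / (2 * s))\<close>
  would match dimension \<open>s\<close> exactly; the further factor \<open>4 powr - k\<close> makes room for the jitter and for
  gaps between cells, even for \<open>s = 1\<close>, and is negligible at the level of exponents.\<close>

definition cell_exp :: "real \<Rightarrow> nat \<Rightarrow> real" where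
  "cell_exp s k = real k * (real k + 1) / (2 * s) + 2 * real k"

definition cell_length :: "real \<Rightarrow> nat \<Rightarrow> real" where
  "cell_length s k = 2 powr - cell_exp s k"

definition weight :: "nat \<Rightarrow> nat \<Rightarrow> real" where
  "weight j k = (if j = 0 then 2 else 1) / (2 ^ k + 1)"

lemma weight_pos: "0 < weight j k"
  by (simp add: weight_def add_pos_pos)

lemma weight_le: "weight j k \<le> 2 / 2 ^ k"
proof -
  have "weight j k \<le> 2 / (2 ^ k + 1)"
    by (auto simp: weight_def intro!: divide_right_mono)
  also have "\<dots> \<le> 2 / 2 ^ k"
    by (intro divide_left_mono mult_pos_pos add_pos_pos) auto
  finally show ?thesis .
qed

lemma weight_ge: "1 / (2 ^ k + 1) \<le> weight j k"
  by (auto simp: weight_def intro!: divide_right_mono)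

lemma weight_sum: "(\<Sum>j<2 ^ k. weight j k) = 1"
proof -
  have "(\<Sum>j<2 ^ k. weight j k) = (\<Sum>j<(2::nat) ^ k. (1 + (if j = 0 then 1 else 0)) / (2 ^ k + 1))"
    by (intro sum.cong) (auto simp: weight_def)
  also have "\<dots> = (\<Sum>j<(2::nat) ^ k. 1 + (if j = 0 then 1 else 0)) / (2 ^ k + 1)"
    by (rule sum_divide_distrib[symmetric])
  also have "(\<Sum>j<(2::nat) ^ k. 1 + (if j = 0 then 1 else 0)) = (2 ^ k + 1 :: real)"
    by (simp add: sum.distrib)
  finally show ?thesis
    using add_pos_pos[of "2 ^ k" "1::real"] by simp
qed

lemma cell_length_pos: "0 < cell_length s k"
  by (simp add: cell_length_def)

lemma cell_length_0 [simp]: "cell_length s 0 = 1"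
  by (simp add: cell_length_def cell_exp_def)

lemma cell_exp_Suc:
  assumes "0 < s"
  shows "cell_exp s (Suc k) = cell_exp s k + (real k + 1) / s + 2"
  using assms by (simp add: cell_exp_def field_simps)

text \<open>A slot has room for four cells of the next generation: one length is given to the
  jitter, and the other three are the separation required by \<open>x_separated\<close>. The bound
  \<open>s \<le> 1\<close> makes \<open>(k + 1) / s\<close> at least \<open>k + 1\<close>, which
  pays for the number of slots; the factor \<open>4 powr - k\<close> provides the 4.\<close>

lemma cell_length_Suc_le:
  assumes "0 < s" "s \<le> 1"
  shows "4 * cell_length s (Suc k) \<le> cell_length s k / 2 ^ Suc k"
proof -
  have "(real k + 1) / 1 \<le> (real k + 1) / s"
    using assms by (intro divide_left_mono) auto
  then have "cell_length s (Suc k) \<le> 2 powr (- cell_exp s k - real (Suc k) - 2)"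
    unfolding cell_length_def cell_exp_Suc[OF assms(1)] by (intro powr_mono) auto
  also have "\<dots> = cell_length s k / 2 ^ Suc k / 4"
    unfolding cell_length_def by (simp only: powr_diff powr_realpow zero_less_numeral powr_numeral) simp
  finally show ?thesis by simp
qed

lemma cell_length_Suc_le_half:
  assumes "0 < s" "s \<le> 1"
  shows "cell_length s (Suc k) \<le> cell_length s k / 2"
proof -
  have "cell_length s k / 2 ^ Suc k \<le> cell_length s k / 1"
    using cell_length_pos[of s k] one_le_power[of "2::real" "Suc k"]
    by (intro divide_left_mono) (simp_all del: power_Suc)
  then show ?thesis using cell_length_Suc_le[OF assms, of k] cell_length_pos[of s "Suc k"] by linarith
qed

lemma cell_length_tendsto_0:
  assumes "0 < s" "s \<le> 1"
  shows "cell_length s \<longlonglongrightarrow> 0"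
proof (rule tendsto_sandwich)
  show "eventually (\<lambda>k. 0 \<le> cell_length s k) sequentially" by (simp add: cell_length_pos less_imp_le)
  have "cell_length s k \<le> (1/2) ^ k" for k
    by (induction k) (use cell_length_Suc_le_half[OF assms] in \<open>auto intro: order_trans\<close>)
  then show "eventually (\<lambda>k. cell_length s k \<le> (1/2) ^ k) sequentially" by simp
  show "(\<lambda>k. (1/2) ^ k :: real) \<longlonglongrightarrow> 0" by (rule LIMSEQ_realpow_zero) auto
qed simp

lemma decseq_cell_length:
  assumes "0 < s" "s \<le> 1" shows "decseq (cell_length s)"
proof (rule decseq_SucI)
  show "cell_length s (Suc k) \<le> cell_length s k" for k
    using cell_length_Suc_le_half[OF assms, of k] cell_length_pos[of s k] by linarith
qed

lemma cell_length_bracket: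
  assumes "0 < s" "s \<le> 1" "0 < r" "r \<le> 1"
  obtains k where "cell_length s (Suc k) < r" "r \<le> cell_length s k"
proof -
  obtain m where m: "cell_length s m < r"
    using order_tendstoD(2)[OF cell_length_tendsto_0[OF assms(1,2)] assms(3)]
    by (auto simp: eventually_sequentially)
  have "\<not> cell_length s 0 < r" using assms(4) by simp
  from ex_least_nat_less[of "\<lambda>k. cell_length s k < r", OF m this]
  obtain k where "\<not> cell_length s k < r" "cell_length s (Suc k) < r" by blast
  then show ?thesis using that[of k] by simp
qed

text \<open>A factor \<open>cell_length s k powr \<epsilon>\<close> is thus at most
  \<open>2 powr\<close> a negative quadratic in \<open>k\<close>, enough to absorb all subquadratic
  losses.\<close>

lemma cell_exp_ge:
  assumes "0 < s" "s \<le> 1"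
  shows "(real k)\<^sup>2 / 2 \<le> cell_exp s k"
proof -
  have "(real k)\<^sup>2 \<le> real k * (real k + 1)" by (simp add: power2_eq_square algebra_simps)
  then have "(real k)\<^sup>2 / 2 \<le> real k * (real k + 1) / (2 * 1)" by simp
  also have "\<dots> \<le> real k * (real k + 1) / (2 * s)"
    using assms by (intro divide_left_mono) auto
  finally show ?thesis by (simp add: cell_exp_def)
qed

lemma mult_cell_exp_Suc:
  assumes "0 < s"
  shows "s * cell_exp s (Suc k) = (real k + 1) * (real k + 2) / 2 + 2 * s * (real k + 1)"
  using assms by (simp add: cell_exp_def field_simps)

text \<open>The bracket is the loss per stage of the Fourier estimate as an exponent of 2: a
  constant, the polynomial factor, and the uncontrolled stages. The linear terms come from
  neighbouring generations.\<close>

lemma subquadratic_bounded: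
  fixes a e :: real
  assumes "0 < e"
  obtains C where
    "\<And>k::nat. real k * (a + 2 * log 2 (real k + 1) + sqrt (real k + 1)) + 4 * real k + 4 - e * (real k)\<^sup>2 \<le> C"
proof -
  let ?f = "\<lambda>k::nat. real k * (a + 2 * log 2 (real k + 1) + sqrt (real k + 1)) + 4 * real k + 4 - e * (real k)\<^sup>2"
  have "filterlim ?f at_bot sequentially"
    using assms by real_asymp
  then have "eventually (\<lambda>k. ?f k \<le> 0) sequentially"
    unfolding filterlim_at_bot by (rule spec)
  then obtain m where m: "\<And>k. m \<le> k \<Longrightarrow> ?f k \<le> 0"
    by (auto simp: eventually_sequentially)
  have "?f k \<le> Max (insert 0 (?f ` {..<m}))" for k
  proof (cases "k < m")
    case False
    then have "?f k \<le> 0" using m by simp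
    also have "0 \<le> Max (insert 0 (?f ` {..<m}))" by (rule Max_ge) auto
    finally show ?thesis .
  qed (rule Max_ge, auto)
  then show thesis using that by blast
qed

lemma linear_minus_quadratic_bounded:
  fixes e :: real
  assumes "0 < e"
  obtains C where "\<And>k::nat. 4 * real k + 4 - e * (real k)\<^sup>2 \<le> C"
proof -
  obtain C where C: "\<And>k::nat. real k * (0 + 2 * log 2 (real k + 1) + sqrt (real k + 1)) + 4 * real k + 4 - e * (real k)\<^sup>2 \<le> C"
    using subquadratic_bounded[OF assms] by blast
  have "4 * real k + 4 - e * (real k)\<^sup>2 \<le> C" for k
  proof -
    have "0 \<le> real k * (0 + 2 * log 2 (real k + 1) + sqrt (real k + 1))"
      by (intro mult_nonneg_nonneg add_nonneg_nonneg) auto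
    then show ?thesis using C[of k] by linarith
  qed
  then show thesis using that by blast
qed

lemma slot_end_le:
  assumes "j < 2 ^ Suc k"
  shows "real j * cell_length s k / 2 ^ Suc k + cell_length s k / 2 ^ Suc k \<le> cell_length s k"
proof -
  have "real (Suc j) \<le> real (2 ^ Suc k)" using assms by (intro of_nat_mono) simp
  then have "(real j + 1) * (cell_length s k / 2 ^ Suc k) \<le> 2 ^ Suc k * (cell_length s k / 2 ^ Suc k)"
    using cell_length_pos[of s k] by (intro mult_right_mono) auto
  also have "\<dots> = cell_length s k" by simp
  finally show ?thesis
    by (simp only: distrib_right mult_1_left times_divide_eq_right add_divide_distrib)
qed

lemma sum_real_lessThan: "(\<Sum>i<k. real i) = real k * (real k - 1) / 2" for k :: nat
  by (induction k) (auto simp: field_simps)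

lemma prod_powr_real:
  "(\<Prod>i<k. 2 powr f i) = 2 powr (\<Sum>i<k. f i :: real)" for k :: nat
  by (induction k) (auto simp: powr_add)

text \<open>Each stage is treated separately by \<open>exists_jitter\<close>. Its window has
  \<open>2 powr\<close> order \<open>m ^ 4\<close> grid points, where
  \<open>m = real (Suc k)\<close>, so a threshold \<open>T\<close> of order \<open>m\<^sup>2\<close>
  makes the union bound succeed at the price of a polynomial factor.\<close>

lemma exists_stage_jitter:
  assumes s: "0 < s" "s \<le> 1"
  obtains B u where "1 \<le> B" "\<And>k j. 0 \<le> u k j \<and> u k j \<le> 1"
    "\<And>k t. t \<noteq> 0 \<Longrightarrow> \<bar>t\<bar> \<le> 2 * pi / cell_length s ((Suc k)\<^sup>2) \<Longrightarrow>
       cmod (\<Sum>j<2 ^ Suc k. weight j (Suc k) *\<^sub>R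
           iexp (t * (real j * cell_length s k / 2 ^ Suc k + u k j * cell_length s (Suc k))))
         \<le> B * (real (Suc k))\<^sup>2 * 2 powr - (real (Suc k) / 2) + 4 / (\<bar>t\<bar> * cell_length s (Suc k))"
proof -
  \<comment> \<open>With \<open>T = A * m\<^sup>2\<close> this gives
    \<open>T\<^sup>2 / 8 = (1 / s + 8) * m ^ 4\<close>, the exponent that bounds the grid count
    below.\<close>
  define A where "A = sqrt (8 * (1 / s + 8))"
  have A: "A\<^sup>2 = 8 * (1 / s + 8)" "0 \<le> A" using s by (auto simp: A_def)
  define good where "good k v \<longleftrightarrow> (\<forall>j. 0 \<le> v j \<and> v j \<le> 1) \<and>
      (\<forall>t. t \<noteq> 0 \<longrightarrow> \<bar>t\<bar> \<le> 2 * pi / cell_length s ((Suc k)\<^sup>2) \<longrightarrow>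
       cmod (\<Sum>j<2 ^ Suc k. weight j (Suc k) *\<^sub>R
           iexp (t * (real j * cell_length s k / 2 ^ Suc k + v j * cell_length s (Suc k))))
         \<le> (2 * A + 1) * (real (Suc k))\<^sup>2 * 2 powr - (real (Suc k) / 2) + 4 / (\<bar>t\<bar> * cell_length s (Suc k)))" for k and v :: "nat \<Rightarrow> real"
  have ex: "\<exists>v. good k v" for k
  proof -
    define m where "m = real (Suc k)"
    have m: "1 \<le> m" by (simp add: m_def)
    define T where "T = A * m\<^sup>2"
    \<comment> \<open>The mesh is \<open>1 / sqrt N\<close>, so that discretisation costs no more
      than the square-root bound itself.\<close>
    define d where "d = 2 powr - (m / 2)"
    have "2 powr m = 2 ^ Suc k" unfolding m_def by (rule powr_realpow) simp
    then have "sqrt (real (2 ^ Suc k)) = (2 powr m) powr (1 / 2)"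
      by (simp add: powr_half_sqrt)
    also have "\<dots> = 2 powr (m / 2)" by (simp add: powr_powr)
    finally have d: "1 / sqrt (real (2 ^ Suc k)) = d"
      by (simp only: d_def powr_minus_divide)
    define R where "R = 2 * pi / cell_length s ((Suc k)\<^sup>2)"
    have m4: "m\<^sup>2 \<le> m ^ 4" "m \<le> m ^ 4" "1 \<le> m ^ 4"
      using m power_increasing[of 2 4 m] power_increasing[of 1 4 m] power_increasing[of 0 4 m] by auto
    have E: "cell_exp s ((Suc k)\<^sup>2) \<le> (1 / s + 2) * m ^ 4"
    proof -
      have "cell_exp s ((Suc k)\<^sup>2) = (m ^ 4 + m\<^sup>2) / 2 / s + 2 * m\<^sup>2"
        by (simp add: cell_exp_def m_def power_numeral_reduce algebra_simps add_divide_distrib)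
      also have "\<dots> \<le> m ^ 4 / s + 2 * m ^ 4"
        using m4 s by (intro add_mono divide_right_mono) auto
      finally show ?thesis by (simp add: algebra_simps)
    qed
    have "R / d + 1 = 2 * pi * 2 powr (cell_exp s ((Suc k)\<^sup>2) + m / 2) + 1"
      by (simp add: R_def d_def cell_length_def powr_minus_divide powr_add)
    also have "\<dots> \<le> 7 * 2 powr ((1 / s + 3) * m ^ 4) + 1 * 2 powr ((1 / s + 3) * m ^ 4)"
    proof (rule add_mono)
      have "cell_exp s ((Suc k)\<^sup>2) + m / 2 \<le> (1 / s + 3) * m ^ 4"
        using E m4 m by (simp add: algebra_simps)
      then show "2 * pi * 2 powr (cell_exp s ((Suc k)\<^sup>2) + m / 2) \<le> 7 * 2 powr ((1 / s + 3) * m ^ 4)"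
        using pi_approx by (intro mult_mono powr_mono) auto
      have "0 \<le> (1 / s + 3) * m ^ 4" using m4 s by (intro mult_nonneg_nonneg) auto
      then show "1 \<le> 1 * 2 powr ((1 / s + 3) * m ^ 4)"
        using ge_one_powr_ge_zero[of 2] by simp
    qed
    finally have "R / d + 1 \<le> 8 * 2 powr ((1 / s + 3) * m ^ 4)" by simp
    then have "(R / d + 1) * 4 \<le> 8 * 2 powr ((1 / s + 3) * m ^ 4) * 4"
      by (rule mult_right_mono) simp
    also have "\<dots> = 2 powr (5 + (1 / s + 3) * m ^ 4)" by (simp add: powr_add)
    also have "\<dots> \<le> 2 powr ((1 / s + 8) * m ^ 4)"
      using m4 by (intro powr_mono) (auto simp: algebra_simps)
    \<comment> \<open>The strict inequality of the union bound comes from passing from base 2 to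
      base \<open>exp 1\<close>.\<close>
    also have "\<dots> < exp 1 powr ((1 / s + 8) * m ^ 4)"
      using m4 s exp_lower_Taylor_quadratic[of 1]
      by (intro powr_less_mono2) (auto intro!: mult_pos_pos add_pos_pos)
    also have "\<dots> = exp (T\<^sup>2 / 8)"
      using A(1) by (simp add: powr_def T_def power_mult_distrib power_mult[symmetric])
    finally have small: "(R / d + 1) * (4 * exp (- T\<^sup>2 / 8)) < 1"
      by (simp add: exp_minus field_simps)
    obtain v where v: "\<And>j. 0 \<le> v j \<and> v j \<le> 1"
      "\<And>t. t \<noteq> 0 \<Longrightarrow> \<bar>t\<bar> \<le> R \<Longrightarrow>
        cmod (\<Sum>j<2 ^ Suc k. weight j (Suc k) *\<^sub>R
           iexp (t * (real j * cell_length s k / 2 ^ Suc k + v j * cell_length s (Suc k))))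
         \<le> 2 * T / sqrt (real (2 ^ Suc k)) + 4 / (\<bar>t\<bar> * cell_length s (Suc k)) + d"
    proof (rule exists_jitter[where N = "2 ^ Suc k" and p = "\<lambda>j. weight j (Suc k)"
          and b = "\<lambda>j. real j * cell_length s k / 2 ^ Suc k" and l = "cell_length s (Suc k)"
          and T = T and \<delta> = d and R = R])
      show "weight j (Suc k) \<le> 2 / real (2 ^ Suc k)" for j
        using weight_le[of j "Suc k"] by simp
      show "real j * cell_length s k / 2 ^ Suc k + cell_length s (Suc k) \<le> 1" if "j < 2 ^ Suc k" for j
        using slot_end_le[OF that, of s] cell_length_Suc_le[OF s, of k] cell_length_pos[of s "Suc k"]
          decseqD[OF decseq_cell_length[OF s], of 0 k] cell_length_0[of s]
        by linarith
    qed (use small A(2) weight_sum[of "Suc k"] weight_pos cell_length_pos in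
        \<open>auto simp: less_imp_le T_def d_def R_def\<close>)
    have "2 * T / sqrt (real (2 ^ Suc k)) + d = (2 * A * m\<^sup>2 + 1) * d"
      by (simp add: d[symmetric] T_def algebra_simps)
    also have "\<dots> \<le> (2 * A * m\<^sup>2 + 1 * m\<^sup>2) * d"
      using m by (intro mult_right_mono) (auto simp: d_def)
    finally have "2 * T / sqrt (real (2 ^ Suc k)) + d \<le> (2 * A + 1) * m\<^sup>2 * d"
      by (simp add: algebra_simps)
    then have bound: "2 * T / sqrt (real (2 ^ Suc k)) + q + d \<le> (2 * A + 1) * m\<^sup>2 * d + q" for q
      by simp
    have "cmod (\<Sum>j<2 ^ Suc k. weight j (Suc k) *\<^sub>R
           iexp (t * (real j * cell_length s k / 2 ^ Suc k + v j * cell_length s (Suc k))))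
         \<le> (2 * A + 1) * m\<^sup>2 * d + 4 / (\<bar>t\<bar> * cell_length s (Suc k))"
      if "t \<noteq> 0" "\<bar>t\<bar> \<le> R" for t
      by (rule order_trans[OF v(2)[OF that] bound])
    then show ?thesis
      using v(1) unfolding good_def R_def d_def m_def by blast
  qed
  obtain u where "\<And>k. good k (u k)"
    using ex by metis
  then show thesis
    using A(2) by (intro that[of "2 * A + 1" u]) (auto simp only: good_def)
qed

section \<open>The random Cantor measure\<close>

text \<open>Stages are indexed from 0 here, so stage \<open>k\<close> is the factor with index \<open>Suc k\<close> of the theorem
  and has \<open>2 ^ Suc k\<close> atoms. The bound \<open>decay\<close> reaches frequencies of order
  \<open>1 / cell_length s ((Suc k)\<^sup>2)\<close>; hence at frequencies of order \<open>1 / cell_length s K\<close> only about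
  \<open>sqrt K\<close> of the first \<open>K\<close> factors are not controlled, and these are the smallest stages.\<close>

locale random_cantor =
  fixes s B :: real and u :: "nat \<Rightarrow> nat \<Rightarrow> real"
  assumes s: "0 < s" "s \<le> 1" and B: "1 \<le> B" and u: "0 \<le> u k j" "u k j \<le> 1"
    and decay: "t \<noteq> 0 \<Longrightarrow> \<bar>t\<bar> \<le> 2 * pi / cell_length s ((Suc k)\<^sup>2) \<Longrightarrow>
       cmod (\<Sum>j<2 ^ Suc k. weight j (Suc k) *\<^sub>R
           iexp (t * (real j * cell_length s k / 2 ^ Suc k + u k j * cell_length s (Suc k))))
         \<le> B * (real (Suc k))\<^sup>2 * 2 powr - (real (Suc k) / 2) + 4 / (\<bar>t\<bar> * cell_length s (Suc k))"
begin

definition point :: "nat \<Rightarrow> nat \<Rightarrow> real" where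
  "point j k = real j * cell_length s k / 2 ^ Suc k + u k j * cell_length s (Suc k)"

lemma jitter_bounds:
  "0 \<le> u k j * cell_length s (Suc k)" "u k j * cell_length s (Suc k) \<le> cell_length s (Suc k)"
  using u[of k j] cell_length_pos[of s "Suc k"] by (auto intro: mult_left_le_one_le mult_nonneg_nonneg)

lemma point_nested:
  assumes "j < 2 ^ Suc k"
  shows "point j k + cell_length s (Suc k) \<le> cell_length s k"
  using slot_end_le[OF assms, of s] cell_length_Suc_le[OF s, of k] jitter_bounds(2)[of k j]
    cell_length_pos[of s "Suc k"]
  unfolding point_def by linarith

lemma point_separated:
  assumes "i < j"
  shows "3 * cell_length s (Suc k) \<le> point j k - point i k"
proof -
  have "1 * (cell_length s k / 2 ^ Suc k) \<le> (real j - real i) * (cell_length s k / 2 ^ Suc k)"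
    using assms cell_length_pos[of s k] by (intro mult_right_mono) auto
  also have "\<dots> = real j * cell_length s k / 2 ^ Suc k - real i * cell_length s k / 2 ^ Suc k"
    by (simp only: left_diff_distrib times_divide_eq_right diff_divide_distrib)
  finally show ?thesis
    using cell_length_Suc_le[OF s, of k] jitter_bounds(1)[of k j] jitter_bounds(2)[of k i]
    unfolding point_def by linarith
qed

sublocale separated_convolution "\<lambda>k. 2 ^ Suc k" "\<lambda>j k. weight j (Suc k)" point "cell_length s"
proof
  fix i j k :: nat
  show "0 \<le> point j k"
    unfolding point_def using cell_length_pos[of s k]
    by (intro add_nonneg_nonneg jitter_bounds(1)) auto
  assume "i \<noteq> j"
  then consider "i < j" | "j < i" by linarith
  then show "3 * cell_length s (Suc k) \<le> \<bar>point i k - point j k\<bar>"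
    using point_separated[of i j k] point_separated[of j i k] by cases linarith+
qed (use point_nested cell_length_tendsto_0[OF s] in
    \<open>auto simp: weight_pos cell_length_pos weight_sum simp del: power_Suc\<close>)

section \<open>Regularity and dimension\<close>

text \<open>The radius is bracketed by two consecutive generations. Both
  \<open>s * cell_exp s k\<close> and the exponent of the lightest cylinder are half of
  \<open>k\<^sup>2\<close> up to linear terms, which \<open>\<epsilon> * cell_exp s k\<close>
  absorbs.\<close>

lemma measure_ball_lower:
  assumes "0 < \<epsilon>"
  obtains c where "0 < c"
    "\<And>y r. y \<in> cantor_set \<Longrightarrow> 0 < r \<Longrightarrow> r \<le> 1 \<Longrightarrow> c * r powr (s + \<epsilon>) \<le> measure limit_measure (ball y r)"
proof -
  obtain C where C: "\<And>k::nat. 4 * real k + 4 - \<epsilon> / 2 * (real k)\<^sup>2 \<le> C"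
    using linear_minus_quadratic_bounded[of "\<epsilon> / 2"] assms by auto
  show thesis
  proof (rule that[of "2 powr - C"])
    fix y r :: real assume y: "y \<in> cantor_set" and r: "0 < r" "r \<le> 1"
    obtain k where k: "cell_length s (Suc k) < r" "r \<le> cell_length s k"
      using cell_length_bracket[OF s r] by blast
    have "2 powr - C * r powr (s + \<epsilon>) \<le> 2 powr - C * cell_length s k powr (s + \<epsilon>)"
      using k r s assms by (intro mult_left_mono powr_mono2) auto
    also have "\<dots> = 2 powr (- C - (s * cell_exp s k + \<epsilon> * cell_exp s k))"
      by (simp add: cell_length_def powr_powr powr_add[symmetric] algebra_simps)
    also have "\<dots> \<le> 2 powr (\<Sum>i<Suc k. - (real i + 2))"
    proof (rule powr_mono)
      have "\<epsilon> * ((real k)\<^sup>2 / 2) \<le> \<epsilon> * cell_exp s k"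
        using cell_exp_ge[OF s] assms by (intro mult_left_mono) auto
      moreover have "s * cell_exp s k = real k * (real k + 1) / 2 + 2 * s * real k"
        using s by (simp add: cell_exp_def field_simps)
      moreover have "0 \<le> 2 * s * real k" using s by simp
      moreover have "(\<Sum>i<Suc k. - (real i + 2)) = - (real k * (real k + 1) / 2 + 2 * (real k + 1))"
        unfolding sum_negf by (simp add: sum.distrib sum_real_lessThan field_simps)
      ultimately show "- C - (s * cell_exp s k + \<epsilon> * cell_exp s k) \<le> (\<Sum>i<Suc k. - (real i + 2))"
        using C[of k] by (simp add: algebra_simps)
    qed simp
    also have "\<dots> = (\<Prod>i<Suc k. 2 powr - (real i + 2))"
      by (rule prod_powr_real[symmetric])
    also have "\<dots> \<le> measure limit_measure (ball y r)"
    proof (rule measure_ball_ge[OF y k(1)])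
      fix i j :: nat
      have "2 powr - (real i + 2) = 1 / 2 ^ (i + 2)"
        using powr_realpow[of 2 "i + 2"] by (simp only: powr_minus_divide of_nat_add of_nat_numeral zero_less_numeral)
      also have "\<dots> \<le> 1 / (2 ^ Suc i + 1)"
      proof (rule divide_left_mono)
        have "(2::real) ^ (i + 2) = 2 * 2 ^ Suc i" by simp
        then show "(2::real) ^ Suc i + 1 \<le> 2 ^ (i + 2)"
          using one_le_power[of "2::real" "Suc i"] by linarith
      qed (auto intro!: mult_pos_pos add_pos_pos)
      also have "\<dots> \<le> weight j (Suc i)" by (rule weight_ge)
      finally show "2 powr - (real i + 2) \<le> weight j (Suc i)" .
    qed simp
    finally show "2 powr - C * r powr (s + \<epsilon>) \<le> measure limit_measure (ball y r)" .
  qed simp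
qed

lemma measure_ball_upper:
  assumes "0 < \<epsilon>"
  obtains C where "0 < C"
    "\<And>y r. y \<in> cantor_set \<Longrightarrow> 0 < r \<Longrightarrow> r \<le> 1 \<Longrightarrow> measure limit_measure (ball y r) \<le> C * r powr (s - \<epsilon>)"
proof -
  obtain C where C: "\<And>k::nat. 4 * real k + 4 - \<epsilon> / 2 * (real k)\<^sup>2 \<le> C"
    using linear_minus_quadratic_bounded[of "\<epsilon> / 2"] assms by auto
  show thesis
  proof (rule that[of "2 powr C"])
    fix y r :: real assume y: "y \<in> cantor_set" and r: "0 < r" "r \<le> 1"
    obtain k where k: "cell_length s (Suc k) < r" "r \<le> cell_length s k"
      using cell_length_bracket[OF s r] by blast
    have "measure limit_measure (ball y r) \<le> (\<Prod>i<k. 2 powr - real i)"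
    proof (rule measure_ball_le[OF y k(2)])
      fix i j :: nat
      have "weight j (Suc i) \<le> 2 / 2 ^ Suc i" by (rule weight_le)
      also have "\<dots> = 2 powr - real i" by (simp add: powr_minus_divide powr_realpow)
      finally show "weight j (Suc i) \<le> 2 powr - real i" .
    qed
    also have "\<dots> = 2 powr (\<Sum>i<k. - real i)" by (rule prod_powr_real)
    also have "\<dots> \<le> 2 powr (C + (- (s * cell_exp s (Suc k)) + \<epsilon> * cell_exp s k))"
    proof (rule powr_mono)
      have "\<epsilon> * ((real k)\<^sup>2 / 2) \<le> \<epsilon> * cell_exp s k"
        using cell_exp_ge[OF s] assms by (intro mult_left_mono) auto
      moreover have "2 * s * (real k + 1) \<le> 2 * 1 * (real k + 1)"
        using s by (intro mult_right_mono mult_left_mono) auto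
      moreover have "(\<Sum>i<k. - real i) = - (real k * (real k - 1) / 2)"
        by (simp add: sum_negf sum_real_lessThan)
      ultimately show "(\<Sum>i<k. - real i) \<le> C + (- (s * cell_exp s (Suc k)) + \<epsilon> * cell_exp s k)"
        using C[of k] unfolding mult_cell_exp_Suc[OF s(1)] by (simp add: field_simps)
    qed simp
    \<comment> \<open>Powers with exponents \<open>s\<close> and \<open>- \<epsilon>\<close> are
      monotone in opposite directions, so \<open>r\<close> is compared with the lower end of its
      bracket in the first and with the upper end in the second.\<close>
    also have "\<dots> = 2 powr C * (cell_length s (Suc k) powr s * cell_length s k powr - \<epsilon>)"
      by (simp add: cell_length_def powr_powr powr_add[symmetric] mult.commute)
    also have "\<dots> \<le> 2 powr C * (r powr s * r powr - \<epsilon>)"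
      using k r s assms cell_length_pos
      by (intro mult_left_mono mult_mono powr_mono2 powr_mono2') (auto simp: less_imp_le)
    also have "\<dots> = 2 powr C * r powr (s - \<epsilon>)"
      by (simp add: powr_add[symmetric])
    finally show "measure limit_measure (ball y r) \<le> 2 powr C * r powr (s - \<epsilon>)" .
  qed simp
qed

text \<open>The number of words times \<open>cell_length s k powr s\<close> is at most 1, so the
  excess \<open>t / s - 1\<close> leaves geometric decay.\<close>

lemma card_words_cell_length_tendsto_0:
  assumes "s < t"
  shows "(\<lambda>k. real (card (\<Pi>\<^sub>E i\<in>{..<k}. {..<(2::nat) ^ Suc i})) * cell_length s k powr t) \<longlonglongrightarrow> 0"
proof (rule tendsto_sandwich[where f = "\<lambda>_. 0"])
  define a where "a = t / s"
  have a: "1 < a" "t = a * s" using assms s by (auto simp: a_def)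
  show "eventually (\<lambda>k. real (card (\<Pi>\<^sub>E i\<in>{..<k}. {..<(2::nat) ^ Suc i})) * cell_length s k powr t
     \<le> (2 powr - (a - 1)) ^ k) sequentially"
  proof (rule always_eventually, rule allI)
    fix k :: nat
    have "real (card (\<Pi>\<^sub>E i\<in>{..<k}. {..<(2::nat) ^ Suc i})) = (\<Prod>i<k. 2 powr (real i + 1))"
      by (simp add: card_PiE powr_add powr_realpow mult.commute)
    also have "\<dots> = 2 powr (real k * (real k + 1) / 2)"
      unfolding prod_powr_real by (simp add: sum.distrib sum_real_lessThan field_simps)
    finally have "real (card (\<Pi>\<^sub>E i\<in>{..<k}. {..<(2::nat) ^ Suc i})) * cell_length s k powr t
        = 2 powr (real k * (real k + 1) / 2 - a * (s * cell_exp s k))"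
      by (simp add: cell_length_def powr_powr powr_add[symmetric] a(2) mult_ac)
    also have "\<dots> \<le> 2 powr (- (a - 1) * real k)"
    proof (rule powr_mono)
      define q where "q = real k * (real k + 1) / 2"
      have "s * cell_exp s k = q + 2 * s * real k"
        using s by (simp add: q_def cell_exp_def field_simps)
      then have "a * q \<le> a * (s * cell_exp s k)"
        using a s by (intro mult_left_mono) auto
      moreover have "real k \<le> q"
        by (cases k) (auto simp: q_def field_simps)
      then have "(a - 1) * real k \<le> (a - 1) * q"
        using a by (intro mult_left_mono) auto
      ultimately have "q - a * (s * cell_exp s k) \<le> - (a - 1) * real k"
        by (simp add: left_diff_distrib)
      then show "real k * (real k + 1) / 2 - a * (s * cell_exp s k) \<le> - (a - 1) * real k"
        by (simp only: q_def)
    qed simp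
    also have "\<dots> = (2 powr - (a - 1)) ^ k"
      by (simp add: powr_powr powr_realpow[symmetric])
    finally show "real (card (\<Pi>\<^sub>E i\<in>{..<k}. {..<(2::nat) ^ Suc i})) * cell_length s k powr t
       \<le> (2 powr - (a - 1)) ^ k" .
  qed
  have "2 powr - (a - 1) < 2 powr 0" using a by (intro powr_less_mono) auto
  then show "(\<lambda>k. (2 powr - (a - 1)) ^ k) \<longlonglongrightarrow> 0" by (intro LIMSEQ_realpow_zero) auto
qed auto

lemma hausdorff_dim_cantor_set: "hausdorff_dim cantor_set = ennreal s"
proof (rule hausdorff_dim_eqI)
  fix t assume t: "s < t"
  show "hausdorff_measure t cantor_set = 0"
  proof (rule hausdorff_measure_eq_0_if_covers[where I = "\<lambda>k. \<Pi>\<^sub>E i\<in>{..<k}. {..<2 ^ Suc i}"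
        and A = "\<lambda>k J. cylinder J k" and L = "cell_length s"])
    show "(\<lambda>k. real (card (\<Pi>\<^sub>E i\<in>{..<k}. {..<(2::nat) ^ Suc i})) * cell_length s k powr t) \<longlonglongrightarrow> 0"
      by (rule card_words_cell_length_tendsto_0[OF t])
    show "cantor_set \<subseteq> (\<Union>J\<in>(\<Pi>\<^sub>E i\<in>{..<k}. {..<2 ^ Suc i}). cylinder J k)" for k
      unfolding cantor_set_def by blast
    show "bounded (cylinder J k)" "diameter (cylinder J k) \<le> cell_length s k" for J k
      using L_pos[of k] by (auto simp: cylinder_def)
  qed (use s t L_lim in \<open>auto intro!: finite_PiE\<close>)
next
  interpret lim: real_distribution limit_measure by (rule real_distribution_limit_measure)
  fix t assume t: "0 \<le> t" "t < s"
  \<comment> \<open>Taking \<open>\<epsilon> = s - t\<close> in the upper ball estimate produces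
    exactly the exponent \<open>t\<close>.\<close>
  have "0 < s - t" using t by simp
  from measure_ball_upper[OF this] obtain C where C: "\<And>y r. y \<in> cantor_set \<Longrightarrow> 0 < r \<Longrightarrow> r \<le> 1 \<Longrightarrow>
      measure limit_measure (ball y r) \<le> C * r powr (s - (s - t))"
    by blast
  show "hausdorff_measure t cantor_set \<noteq> 0"
  proof (rule hausdorff_measure_nonzero_if_ball_le)
    show "prob_space limit_measure" by (rule lim.prob_space_axioms)
    show "measure limit_measure cantor_set = 1" by (rule measure_cantor_set)
    show "measure limit_measure (ball y r) \<le> C * r powr t" if "y \<in> cantor_set" "0 < r" "r \<le> 1" for y r
      using C[OF that] by simp
    show "sets limit_measure = sets borel" by (rule lim.events_eq_borel)
  qed (use t cantor_set_borel in blast)+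
qed (use s in auto)

section \<open>Fourier decay\<close>

text \<open>With \<open>1 / \<bar>\<xi>\<bar>\<close> between the lengths of generations
  \<open>Suc K\<close> and \<open>K\<close>, the stages below \<open>K - 1\<close> suffice: the sum
  of their exponents \<open>(k + 1) / 2\<close> is a quarter of \<open>K\<^sup>2\<close> up to
  linear terms, as is half of \<open>s * cell_exp s (Suc K)\<close>.\<close>

lemma fourier_decay:
  assumes "0 < \<epsilon>"
  obtains C where "\<And>\<xi>. 1 \<le> \<bar>\<xi>\<bar> \<Longrightarrow>
    cmod (fourier_measure limit_measure \<xi>) \<le> C * \<bar>\<xi>\<bar> powr (- s / 2 + \<epsilon>)"
proof -
  define a where "a = log 2 (B + 1)"
  have a: "0 \<le> a" using B by (simp add: a_def)
  obtain C where C: "\<And>k::nat. real k * (a + 2 * log 2 (real k + 1) + sqrt (real k + 1))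
      + 4 * real k + 4 - \<epsilon> / 2 * (real k)\<^sup>2 \<le> C"
    using subquadratic_bounded[of "\<epsilon> / 2" a] assms by auto
  show thesis
  proof (rule that[of "2 powr C"])
    fix \<xi> :: real assume \<xi>: "1 \<le> \<bar>\<xi>\<bar>"
    define t where "t = - 2 * pi * \<xi>"
    have "0 < 1 / \<bar>\<xi>\<bar>" "1 / \<bar>\<xi>\<bar> \<le> 1" using \<xi> by auto
    then obtain K where K: "cell_length s (Suc K) < 1 / \<bar>\<xi>\<bar>" "1 / \<bar>\<xi>\<bar> \<le> cell_length s K"
      using cell_length_bracket[OF s] by blast
    define W where "W = a + 2 * log 2 (real K + 1) + sqrt (real K + 1)"
    \<comment> \<open>The term \<open>sqrt (real K + 1)\<close> in \<open>W\<close> absorbs the uncontrolled stages, for which only the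
      trivial bound 1 is used.\<close>
    have factor: "cmod (char (stage k) t) \<le> 2 powr (W - (real k + 1) / 2)" if "k < K - 1" for k
    proof (cases "K + 1 \<le> (Suc k)\<^sup>2")
      case True
      define m where "m = real (Suc k)"
      define d where "d = 2 powr - (m / 2)"
      have m: "1 \<le> m" "m \<le> real K + 1" using that by (auto simp: m_def)
      have "\<bar>\<xi>\<bar> \<le> 1 / cell_length s (Suc K)"
        using K(1) \<xi> cell_length_pos[of s "Suc K"] by (simp add: field_simps)
      also have "\<dots> \<le> 1 / cell_length s ((Suc k)\<^sup>2)"
        using decseqD[OF decseq_L, of "Suc K" "(Suc k)\<^sup>2"] True cell_length_pos
        by (intro divide_left_mono mult_pos_pos) auto
      finally have "2 * pi * \<bar>\<xi>\<bar> \<le> 2 * pi * (1 / cell_length s ((Suc k)\<^sup>2))"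
        by (rule mult_left_mono) simp
      then have "\<bar>t\<bar> \<le> 2 * pi / cell_length s ((Suc k)\<^sup>2)"
        by (simp add: t_def abs_mult)
      moreover have "t \<noteq> 0" using \<xi> by (auto simp: t_def)
      ultimately have "cmod (char (stage k) t) \<le> B * m\<^sup>2 * d + 4 / (\<bar>t\<bar> * cell_length s (Suc k))"
        using decay[of t k] unfolding char_stage point_def m_def d_def by simp
      also have "4 / (\<bar>t\<bar> * cell_length s (Suc k)) \<le> d"
      proof -
        \<comment> \<open>Here \<open>k < K - 1\<close> matters: the frequency resolves one
          generation beyond the jitter of stage \<open>k\<close>, and the ratio of these two lengths
          makes the mean term smaller than \<open>d\<close>.\<close>
        have "cell_length s K \<le> cell_length s (Suc (Suc k))"
          using that by (intro decseqD[OF decseq_L]) auto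
        then have "4 * (1 / \<bar>\<xi>\<bar>) \<le> cell_length s (Suc k) / 2 ^ Suc (Suc k)"
          using cell_length_Suc_le[OF s, of "Suc k"] K(2) by linarith
        then have "4 * (1 / \<bar>\<xi>\<bar>) / cell_length s (Suc k)
            \<le> cell_length s (Suc k) / 2 ^ Suc (Suc k) / cell_length s (Suc k)"
          using cell_length_pos[of s "Suc k"] by (intro divide_right_mono) auto
        then have "4 * (1 / \<bar>\<xi>\<bar>) / cell_length s (Suc k) \<le> 1 / 2 ^ Suc (Suc k)"
          using cell_length_pos[of s "Suc k"] by simp
        moreover have "4 / (\<bar>t\<bar> * cell_length s (Suc k)) = 4 * (1 / \<bar>\<xi>\<bar>) / cell_length s (Suc k) / (2 * pi)"
          by (simp add: t_def abs_mult)
        moreover have "4 * (1 / \<bar>\<xi>\<bar>) / cell_length s (Suc k) / (2 * pi)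
            \<le> 4 * (1 / \<bar>\<xi>\<bar>) / cell_length s (Suc k) / 1"
          using cell_length_pos[of s "Suc k"] pi_gt3 by (intro divide_left_mono) auto
        moreover have "1 / 2 ^ Suc (Suc k) = 2 powr - (m + 1)"
        proof -
          have "m + 1 = real (Suc (Suc k))" by (simp add: m_def)
          then show ?thesis by (simp only: powr_minus_divide powr_realpow[OF zero_less_numeral])
        qed
        moreover have "2 powr - (m + 1) \<le> d"
          using m unfolding d_def by (intro powr_mono) auto
        ultimately show ?thesis by linarith
      qed
      also have "B * m\<^sup>2 * d + d \<le> B * m\<^sup>2 * d + m\<^sup>2 * d"
        using m by (simp add: d_def)
      also have "\<dots> = (B + 1) * m\<^sup>2 * d" by (simp add: algebra_simps)
      also have "\<dots> \<le> (B + 1) * (real K + 1)\<^sup>2 * d"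
        using m B by (intro mult_right_mono mult_left_mono power_mono) (auto simp: d_def)
      also have "\<dots> = 2 powr (a + 2 * log 2 (real K + 1) - m / 2)"
      proof -
        have "2 powr (2 * log 2 (real K + 1)) = (2 powr log 2 (real K + 1)) powr 2"
          by (simp only: powr_powr mult.commute)
        then have "(real K + 1)\<^sup>2 = 2 powr (2 * log 2 (real K + 1))" by simp
        moreover have "B + 1 = 2 powr a" using B by (simp add: a_def)
        ultimately show ?thesis
          by (simp only: d_def powr_add[symmetric] diff_conv_add_uminus)
      qed
      also have "\<dots> \<le> 2 powr (W - (real k + 1) / 2)"
        by (intro powr_mono) (auto simp: W_def m_def add.commute)
      finally show ?thesis by simp
    next
      case False
      then have "real ((Suc k)\<^sup>2) \<le> real (K + 1)" by (intro of_nat_mono) simp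
      then have "real (Suc k) \<le> sqrt (real K + 1)" by (intro real_le_rsqrt) simp
      then have "(real k + 1) / 2 \<le> sqrt (real K + 1)" by simp
      moreover have "0 \<le> log 2 (real K + 1)" by simp
      ultimately have "0 \<le> W - (real k + 1) / 2"
        using a unfolding W_def by linarith
      then have "1 \<le> 2 powr (W - (real k + 1) / 2)" by (intro ge_one_powr_ge_zero) auto
      then show ?thesis
        using real_distribution.cmod_char_le_1[OF real_distribution_stage, of k t] by linarith
    qed
    have "cmod (fourier_measure limit_measure \<xi>) \<le> (\<Prod>k<K - 1. cmod (char (stage k) t))"
      unfolding fourier_measure_eq_char t_def by (rule cmod_char_limit_measure_le) simp
    also have "\<dots> \<le> (\<Prod>k<K - 1. 2 powr (W - (real k + 1) / 2))"
      using factor by (intro prod_mono) auto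
    also have "\<dots> = 2 powr (\<Sum>k<K - 1. W - (real k + 1) / 2)"
      by (rule prod_powr_real)
    also have "\<dots> \<le> 2 powr (C + (s * cell_exp s (Suc K) * (- 1 / 2) + \<epsilon> * cell_exp s K))"
    proof (rule powr_mono)
      have W: "0 \<le> W" using a by (simp add: W_def)
      have "(\<Sum>k<K - 1. W - (real k + 1) / 2)
          = real (K - 1) * W - real (K - 1) * (real (K - 1) + 1) / 4"
        by (simp add: sum_subtractf sum.distrib sum_divide_distrib[symmetric] sum_real_lessThan field_simps)
      also have "\<dots> \<le> real K * W - real K * (real K - 1) / 4"
        using W by (cases K) (auto simp: algebra_simps)
      finally have "(\<Sum>k<K - 1. W - (real k + 1) / 2) \<le> real K * W - real K * (real K - 1) / 4" .
      moreover have "\<epsilon> * ((real K)\<^sup>2 / 2) \<le> \<epsilon> * cell_exp s K"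
        using cell_exp_ge[OF s] assms by (intro mult_left_mono) auto
      moreover have "2 * s * (real K + 1) \<le> 2 * 1 * (real K + 1)"
        using s by (intro mult_right_mono mult_left_mono) auto
      moreover have "real K * W + 4 * real K + 4 - \<epsilon> / 2 * (real K)\<^sup>2 \<le> C"
        using C[of K] by (simp add: W_def)
      ultimately show "(\<Sum>k<K - 1. W - (real k + 1) / 2)
          \<le> C + (s * cell_exp s (Suc K) * (- 1 / 2) + \<epsilon> * cell_exp s K)"
        unfolding mult_cell_exp_Suc[OF s(1)] by (simp add: field_simps)
    qed simp
    \<comment> \<open>The negative exponent is paired with the upper bound on the frequency, the
      positive one with the lower bound.\<close>
    also have "\<dots> = 2 powr C * ((1 / cell_length s (Suc K)) powr (- s / 2) * (1 / cell_length s K) powr \<epsilon>)"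
      by (simp add: cell_length_def powr_minus_divide[symmetric] powr_powr powr_add[symmetric] mult_ac)
    also have "\<dots> \<le> 2 powr C * (\<bar>\<xi>\<bar> powr (- s / 2) * \<bar>\<xi>\<bar> powr \<epsilon>)"
    proof (intro mult_left_mono mult_mono)
      have "\<bar>\<xi>\<bar> \<le> 1 / cell_length s (Suc K)"
        using K(1) \<xi> cell_length_pos[of s "Suc K"] by (simp add: field_simps)
      then show "(1 / cell_length s (Suc K)) powr (- s / 2) \<le> \<bar>\<xi>\<bar> powr (- s / 2)"
        using s \<xi> by (intro powr_mono2') auto
      have "1 / cell_length s K \<le> \<bar>\<xi>\<bar>"
        using K(2) \<xi> cell_length_pos[of s K] by (simp add: field_simps)
      then show "(1 / cell_length s K) powr \<epsilon> \<le> \<bar>\<xi>\<bar> powr \<epsilon>"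
        using assms cell_length_pos[of s K] by (intro powr_mono2) (auto simp: less_imp_le)
    qed auto
    also have "\<dots> = 2 powr C * \<bar>\<xi>\<bar> powr (- s / 2 + \<epsilon>)" by (simp only: powr_add)
    finally show "cmod (fourier_measure limit_measure \<xi>) \<le> 2 powr C * \<bar>\<xi>\<bar> powr (- s / 2 + \<epsilon>)" .
  qed
qed

end

section \<open>Ratio of the weights and conclusion\<close>

text \<open>The words of zeros and of ones already have weights in ratio \<open>2 ^ k\<close>. The
  second exists because each factor with index \<open>i \<ge> 1\<close> has at least two
  atoms.\<close>

lemma weight_ratio_ge:
  "2 ^ k \<le> Max ((\<lambda>J. \<Prod>i\<in>{1..k}. weight (J i) i) ` (\<Pi>\<^sub>E i\<in>{1..k}. {..<2 ^ i})) /
           Min ((\<lambda>J. \<Prod>i\<in>{1..k}. weight (J i) i) ` (\<Pi>\<^sub>E i\<in>{1..k}. {..<2 ^ i}))"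
proof -
  let ?f = "\<lambda>J. \<Prod>i\<in>{1..k}. weight (J i) i" and ?J = "\<Pi>\<^sub>E i\<in>{1..k}. {..<2 ^ i}"
  define J0 J1 where "J0 = restrict (\<lambda>_. 0::nat) {1..k}" and "J1 = restrict (\<lambda>_. 1::nat) {1..k}"
  have fin: "finite (?f ` ?J)" by (intro finite_imageI finite_PiE) auto
  have J0: "J0 \<in> ?J" by (auto simp: J0_def)
  have "1 < (2::nat) ^ i" if "i \<in> {1..k}" for i using that by (intro one_less_power) auto
  then have J1: "J1 \<in> ?J" unfolding J1_def by (intro restrict_PiE_iff[THEN iffD2]) auto
  have "Min (?f ` ?J) \<in> ?f ` ?J" using fin J0 by (intro Min_in) auto
  then have pos: "0 < Min (?f ` ?J)" by (auto intro!: prod_pos weight_pos)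
  have "2 ^ k * Min (?f ` ?J) \<le> 2 ^ k * ?f J1"
    using fin J1 by (intro mult_left_mono Min_le imageI) auto
  also have "\<dots> = (\<Prod>i\<in>{1..k}. 2 * weight (J1 i) i)"
    by (simp add: prod.distrib)
  also have "\<dots> = ?f J0"
    by (intro prod.cong) (auto simp: J0_def J1_def weight_def)
  also have "?f J0 \<le> Max (?f ` ?J)" using fin J0 by (intro Max_ge) auto
  finally show ?thesis using pos by (simp add: pos_le_divide_eq)
qed

theorem theorem3p1:
  fixes s :: real
  assumes "0 < s" and "s \<le> 1"
  shows "\<exists>(n :: nat \<Rightarrow> nat) (p :: nat \<Rightarrow> nat \<Rightarrow> real) (x :: nat \<Rightarrow> nat \<Rightarrow> real)
            (\<nu> :: nat \<Rightarrow> real measure) (\<mu> :: real measure).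
      (\<forall>k\<ge>1. (\<forall>j<n k. 0 < p j k) \<and> (\<Sum>j<n k. p j k) = 1 \<and>
              inj_on (\<lambda>j. x j k) {..<n k} \<and>
              \<nu> k = discrete_measure (n k) (\<lambda>j. p j k) (\<lambda>j. x j k)) \<and>
      prob_space \<mu> \<and> sets \<mu> = sets borel \<and> measure \<mu> {0..1} = 1 \<and>
      weak_conv_m (conv_upto \<nu>) \<mu> \<and>
      hausdorff_dim (measure_supp \<mu>) = ennreal s \<and>
      (\<forall>\<epsilon>>0. \<exists>C. \<forall>\<xi>. 1 \<le> \<bar>\<xi>\<bar> \<longrightarrow>
          cmod (fourier_measure \<mu> \<xi>) \<le> C * \<bar>\<xi>\<bar> powr (- s / 2 + \<epsilon>)) \<and>
      filterlim
        (\<lambda>k. Max ((\<lambda>J. \<Prod>i\<in>{1..k}. p (J i) i) ` (\<Pi>\<^sub>E i\<in>{1..k}. {..<n i})) /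
             Min ((\<lambda>J. \<Prod>i\<in>{1..k}. p (J i) i) ` (\<Pi>\<^sub>E i\<in>{1..k}. {..<n i})))
        at_top sequentially \<and>
      (\<forall>\<epsilon>>0. \<exists>c>0. \<exists>C>0. \<forall>x\<in>measure_supp \<mu>. \<forall>r. 0 < r \<and> r \<le> 1 \<longrightarrow>
          c * r powr (s + \<epsilon>) \<le> measure \<mu> (ball x r) \<and>
          measure \<mu> (ball x r) \<le> C * r powr (s - \<epsilon>))"
proof -
  obtain B u where "1 \<le> B" "\<And>k j. 0 \<le> u k j \<and> u k j \<le> 1"
    "\<And>k t. t \<noteq> 0 \<Longrightarrow> \<bar>t\<bar> \<le> 2 * pi / cell_length s ((Suc k)\<^sup>2) \<Longrightarrow>
       cmod (\<Sum>j<2 ^ Suc k. weight j (Suc k) *\<^sub>R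
           iexp (t * (real j * cell_length s k / 2 ^ Suc k + u k j * cell_length s (Suc k))))
         \<le> B * (real (Suc k))\<^sup>2 * 2 powr - (real (Suc k) / 2) + 4 / (\<bar>t\<bar> * cell_length s (Suc k))"
    using exists_stage_jitter[OF assms] by blast
  with assms interpret random_cantor s B u
    by unfold_locales blast+
  interpret lim: real_distribution limit_measure by (rule real_distribution_limit_measure)
  define n :: "nat \<Rightarrow> nat" where "n k = 2 ^ k" for k
  \<comment> \<open>Factor \<open>k \<ge> 1\<close> is stage \<open>k - 1\<close>; at
    \<open>k = 0\<close> truncated subtraction yields a dummy entry.\<close>
  define x where "x j k = point j (k - 1)" for j k
  define \<nu> where "\<nu> k = discrete_measure (n k) (\<lambda>j. weight j k) (\<lambda>j. x j k)" for k
  have \<nu>: "\<nu> (Suc k) = stage k" for k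
    by (simp add: \<nu>_def stage_def n_def x_def del: power_Suc)
  have inj: "inj_on (\<lambda>j. x j k) {..<n k}" if "1 \<le> k" for k
    using that x_inj[of "k - 1"] by (cases k) (auto simp: n_def x_def)
  have ratio: "filterlim
      (\<lambda>k. Max ((\<lambda>J. \<Prod>i\<in>{1..k}. weight (J i) i) ` (\<Pi>\<^sub>E i\<in>{1..k}. {..<n i})) /
           Min ((\<lambda>J. \<Prod>i\<in>{1..k}. weight (J i) i) ` (\<Pi>\<^sub>E i\<in>{1..k}. {..<n i})))
      at_top sequentially"
  proof (rule filterlim_at_top_mono)
    show "filterlim (\<lambda>k. 2 ^ k :: real) at_top sequentially"
      by real_asymp
  qed (use weight_ratio_ge in \<open>simp add: n_def\<close>)
  have adr: "\<exists>c>0. \<exists>C>0. \<forall>x\<in>measure_supp limit_measure. \<forall>r. 0 < r \<and> r \<le> 1 \<longrightarrow>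
      c * r powr (s + \<epsilon>) \<le> measure limit_measure (ball x r) \<and>
      measure limit_measure (ball x r) \<le> C * r powr (s - \<epsilon>)" if \<epsilon>: "0 < \<epsilon>" for \<epsilon>
  proof -
    obtain c where c: "0 < c" "\<And>y r. y \<in> cantor_set \<Longrightarrow> 0 < r \<Longrightarrow> r \<le> 1 \<Longrightarrow>
        c * r powr (s + \<epsilon>) \<le> measure limit_measure (ball y r)"
      using measure_ball_lower[OF \<epsilon>] by blast
    obtain C where C: "0 < C" "\<And>y r. y \<in> cantor_set \<Longrightarrow> 0 < r \<Longrightarrow> r \<le> 1 \<Longrightarrow>
        measure limit_measure (ball y r) \<le> C * r powr (s - \<epsilon>)"
      using measure_ball_upper[OF \<epsilon>] by blast
    show ?thesis
      unfolding measure_supp_eq using c C by blast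
  qed
  have fourier: "\<exists>C. \<forall>\<xi>. 1 \<le> \<bar>\<xi>\<bar> \<longrightarrow>
      cmod (fourier_measure limit_measure \<xi>) \<le> C * \<bar>\<xi>\<bar> powr (- s / 2 + \<epsilon>)" if \<epsilon>: "0 < \<epsilon>" for \<epsilon>
    using fourier_decay[OF \<epsilon>] by blast
  show ?thesis
    using measure_limit_measure_interval weak_conv_limit_measure[of \<nu>, OF \<nu>]
      hausdorff_dim_cantor_set inj ratio adr fourier
    by (intro exI[of _ n] exI[of _ weight] exI[of _ x] exI[of _ \<nu>] exI[of _ limit_measure])
      (simp add: weight_pos weight_sum n_def \<nu>_def measure_supp_eq lim.prob_space_axioms del: power_Suc)
qed

end
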